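(* Let $L=\mathrm{diag}(-1,-1,1,1)\in\mathrm{GL}_4(\mathbb{R})$, let $\mathbb{I}_4$ be the identity matrix, let $F=\{\mathbb{I}_4,L\}$, and let $\Gamma$ be the torsion free, discrete and uniform subgroup of $\mathbb{R}^4\rtimes F$ generated by $$a=(e_1,\mathbb{I}_4),\quad b=(e_2,\mathbb{I}_4),\quad c=(e_3,\mathbb{I}_4),\quad d=(e_4,\mathbb{I}_4),\quad f=\left(\left(0,0,\tfrac12,\tfrac12\right)^{T},L\right),$$ where $e_1,\dots,e_4$ is the standard basis of $\mathbb{R}^4$. Let $\alpha:\mathbb{R}^4\to\mathbb{R}^4$ be the affine map $$\alpha(x,y,z,t)=\left(13x+8y+\tfrac12,\ 8x+5y+\tfrac12,\ 13z+8t,\ 8z+5t\right).$$ Then $\alpha\Gamma\alpha^{-1}=\Gamma$, the induced map $\bar\alpha:\Gamma\backslash\mathbb{R}^4\to\Gamma\backslash\mathbb{R}^4:\ \Gamma\cdot v\mapsto\Gamma\cdot\alpha(v)$ is an Anosov diffeomorphism, and $\bar\alpha$ is not topologically conjugate to any infra-nilmanifold automorphism of $\Gamma\backslash\mathbb{R}^4$.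
   Context: The group $\mathrm{Aff}(\mathbb{R}^4)=\mathbb{R}^4\rtimes\mathrm{GL}_4(\mathbb{R})$ acts on $\mathbb{R}^4$ by $(v,A)\cdot x=v+Ax$; the conjugation $\alpha\Gamma\alpha^{-1}$ takes place in $\mathrm{Aff}(\mathbb{R}^4)$, and $F$ is identified with $\{0\}\times F$. Infra-nilmanifold automorphism of $\Gamma\backslash\mathbb{R}^4$: a map of the form $\bar\varphi:\Gamma\backslash\mathbb{R}^4\to\Gamma\backslash\mathbb{R}^4:\ \Gamma\cdot v\mapsto\Gamma\cdot\varphi(v)$, where $\varphi$ is an automorphism of the Lie group $\mathbb{R}^4\rtimes F$ with $\varphi(F)=F$ and $\varphi(\Gamma)=\Gamma$ (then automatically $\varphi(\mathbb{R}^4)=\mathbb{R}^4$, and $\varphi(v)$ refers to the restriction of $\varphi$ to $\mathbb{R}^4$). A diffeomorphism $g$ of a compact manifold $M$ is Anosov if $TM$ has a continuous $Dg$-invariant splitting $TM=E^s\oplus E^u$ such that, for some Riemannian metric and constants $C>0$, $0<\lambda<1$, $\|Dg^k v\|\le C\lambda^k\|v\|$ for $v\in E^s$ and $\|Dg^{-k}v\|\le C\lambda^k\|v\|$ for $v\in E^u$, for all integers $k\ge1$. Two maps $f_1:X\to X$ and $f_2:Y\to Y$ are topologically conjugate if there is a homeomorphism $h:X\to Y$ with $h\circ f_1=f_2\circ h$. *)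

theory Defs
  imports "HOL-Analysis.Analysis" "HOL-Algebra.Generated_Groups"
begin

section \<open>Smooth maps, smooth manifolds and tangent vectors\<close>

text \<open>\<open>C_k_on k S f\<close>: \<open>f\<close> is of class \<open>C^k\<close> on \<open>S\<close>. Only used for open \<open>S\<close>.\<close>

primrec C_k_on ::
  "nat \<Rightarrow> 'a::euclidean_space set \<Rightarrow> ('a \<Rightarrow> 'b::real_normed_vector) \<Rightarrow> bool" where
  "C_k_on 0 S f \<longleftrightarrow> continuous_on S f"
| "C_k_on (Suc k) S f \<longleftrightarrow> (\<forall>x\<in>S. f differentiable (at x)) \<and>
     (\<forall>v. C_k_on k S (\<lambda>x. frechet_derivative f (at x) v))"

definition smooth_on ::
  "'a::euclidean_space set \<Rightarrow> ('a \<Rightarrow> 'b::real_normed_vector) \<Rightarrow> bool" where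
  "smooth_on S f \<longleftrightarrow> (\<forall>k. C_k_on k S f)"

text \<open>A chart is a pair of a domain and a coordinate map; values of the coordinate map outside
  the domain are irrelevant.\<close>

type_synonym ('a, 'b) chart = "'a set \<times> ('a \<Rightarrow> 'b)"

abbreviation param :: "('a, 'b) chart \<Rightarrow> 'b \<Rightarrow> 'a" where
  "param c \<equiv> inv_into (fst c) (snd c)"

definition is_chart :: "'a topology \<Rightarrow> ('a, 'b::euclidean_space) chart \<Rightarrow> bool" where
  "is_chart X c \<longleftrightarrow> openin X (fst c) \<and> open (snd c ` fst c) \<and>
     homeomorphic_map (subtopology X (fst c)) (top_of_set (snd c ` fst c)) (snd c)"

definition smooth_atlas :: "'a topology \<Rightarrow> ('a, 'b::euclidean_space) chart set \<Rightarrow> bool" where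
  "smooth_atlas X A \<longleftrightarrow> (\<forall>c\<in>A. is_chart X c) \<and> (\<Union>c\<in>A. fst c) = topspace X \<and>
     (\<forall>c\<in>A. \<forall>d\<in>A. smooth_on (snd c ` (fst c \<inter> fst d)) (snd d \<circ> param c))"

definition compact_manifold :: "'a topology \<Rightarrow> ('a, 'b::euclidean_space) chart set \<Rightarrow> bool" where
  "compact_manifold X A \<longleftrightarrow>
     compact_space X \<and> Hausdorff_space X \<and> second_countable X \<and> smooth_atlas X A"

definition smooth_map ::
  "'a topology \<Rightarrow> ('a, 'b::euclidean_space) chart set \<Rightarrow> ('a \<Rightarrow> 'a) \<Rightarrow> bool" where
  "smooth_map X A g \<longleftrightarrow> continuous_map X X g \<and>
     (\<forall>c\<in>A. \<forall>d\<in>A. smooth_on (snd c ` {p \<in> fst c. g p \<in> fst d}) (snd d \<circ> g \<circ> param c))"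

definition diffeomorphism ::
  "'a topology \<Rightarrow> ('a, 'b::euclidean_space) chart set \<Rightarrow> ('a \<Rightarrow> 'a) \<Rightarrow> bool" where
  "diffeomorphism X A g \<longleftrightarrow> bij_betw g (topspace X) (topspace X) \<and>
     smooth_map X A g \<and> smooth_map X A (inv_into (topspace X) g)"

definition charts_at :: "('a, 'b) chart set \<Rightarrow> 'a \<Rightarrow> ('a, 'b) chart set" where
  "charts_at A p = {c \<in> A. p \<in> fst c}"

text \<open>A tangent vector at \<open>p\<close> assigns to every chart at \<open>p\<close> a coordinate vector, compatibly with
  the derivatives of the coordinate changes. (It is \<open>0\<close> at the other charts, so that tangent
  vectors are determined by their coordinates.) The vector space operations are pointwise.\<close>

type_synonym ('a, 'b) tvec = "('a, 'b) chart \<Rightarrow> 'b"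

definition tangent_space ::
  "('a, 'b::euclidean_space) chart set \<Rightarrow> 'a \<Rightarrow> ('a, 'b) tvec set" where
  "tangent_space A p = {v. (\<forall>c. c \<notin> charts_at A p \<longrightarrow> v c = 0) \<and>
     (\<forall>c\<in>charts_at A p. \<forall>d\<in>charts_at A p.
        v d = frechet_derivative (snd d \<circ> param c) (at (snd c p)) (v c))}"

text \<open>The tangent vector at \<open>p\<close> having coordinates \<open>e\<close> in the chart \<open>c\<close>.\<close>

definition coord_tvec ::
  "('a, 'b::euclidean_space) chart set \<Rightarrow> ('a, 'b) chart \<Rightarrow> 'a \<Rightarrow> 'b \<Rightarrow> ('a, 'b) tvec" where
  "coord_tvec A c p e = (\<lambda>d. if d \<in> charts_at A p
     then frechet_derivative (snd d \<circ> param c) (at (snd c p)) e else 0)"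

text \<open>The differential of \<open>g\<close> at \<open>p\<close>; the chart chosen at \<open>p\<close> does not matter by the compatibility
  condition on tangent vectors.\<close>

definition differential ::
  "('a, 'b::euclidean_space) chart set \<Rightarrow> ('a \<Rightarrow> 'a) \<Rightarrow> 'a \<Rightarrow> ('a, 'b) tvec \<Rightarrow> ('a, 'b) tvec" where
  "differential A g p v = (\<lambda>d. if d \<in> charts_at A (g p)
     then (let c = (SOME c. c \<in> charts_at A p)
           in frechet_derivative (snd d \<circ> g \<circ> param c) (at (snd c p)) (v c))
     else 0)"

definition riemannian_metric ::
  "'a topology \<Rightarrow> ('a, 'b::euclidean_space) chart set
     \<Rightarrow> ('a \<Rightarrow> ('a, 'b) tvec \<Rightarrow> ('a, 'b) tvec \<Rightarrow> real) \<Rightarrow> bool" where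
  "riemannian_metric X A m \<longleftrightarrow>
     (\<forall>p\<in>topspace X.
        (\<forall>u\<in>tangent_space A p. \<forall>v\<in>tangent_space A p. \<forall>w\<in>tangent_space A p.
           m p (\<lambda>c. u c + v c) w = m p u w + m p v w) \<and>
        (\<forall>r. \<forall>u\<in>tangent_space A p. \<forall>w\<in>tangent_space A p.
           m p (\<lambda>c. r *\<^sub>R u c) w = r * m p u w) \<and>
        (\<forall>u\<in>tangent_space A p. \<forall>w\<in>tangent_space A p. m p u w = m p w u) \<and>
        (\<forall>u\<in>tangent_space A p. u \<noteq> (\<lambda>c. 0) \<longrightarrow> m p u u > 0)) \<and>
     (\<forall>c\<in>A. \<forall>e\<in>Basis. \<forall>e'\<in>Basis. smooth_on (snd c ` fst c)
        (\<lambda>x. m (param c x) (coord_tvec A c (param c x) e) (coord_tvec A c (param c x) e')))"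

text \<open>A continuous subbundle of the tangent bundle: linear subspaces \<open>E p\<close> of the tangent spaces
  that locally have a basis consisting of continuous vector fields.\<close>

definition continuous_subbundle ::
  "'a topology \<Rightarrow> ('a, 'b::euclidean_space) chart set \<Rightarrow> ('a \<Rightarrow> ('a, 'b) tvec set) \<Rightarrow> bool" where
  "continuous_subbundle X A E \<longleftrightarrow>
     (\<forall>p\<in>topspace X. E p \<subseteq> tangent_space A p \<and> (\<lambda>c. 0) \<in> E p \<and>
        (\<forall>u\<in>E p. \<forall>v\<in>E p. (\<lambda>c. u c + v c) \<in> E p) \<and>
        (\<forall>r. \<forall>u\<in>E p. (\<lambda>c. r *\<^sub>R u c) \<in> E p)) \<and>
     (\<forall>p\<in>topspace X. \<exists>U k. \<exists>s :: nat \<Rightarrow> 'a \<Rightarrow> ('a, 'b) tvec. openin X U \<and> p \<in> U \<and>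
        (\<forall>i<k. \<forall>c\<in>A. continuous_map (subtopology X (U \<inter> fst c)) euclidean (\<lambda>q. s i q c)) \<and>
        (\<forall>q\<in>U. (\<forall>i<k. s i q \<in> E q) \<and>
           (\<forall>v\<in>E q. \<exists>!r :: nat \<Rightarrow> real. (\<forall>i\<ge>k. r i = 0) \<and>
              v = (\<lambda>c. \<Sum>i<k. r i *\<^sub>R s i q c))))"

definition continuous_splitting ::
  "'a topology \<Rightarrow> ('a, 'b::euclidean_space) chart set
     \<Rightarrow> ('a \<Rightarrow> ('a, 'b) tvec set) \<Rightarrow> ('a \<Rightarrow> ('a, 'b) tvec set) \<Rightarrow> bool" where
  "continuous_splitting X A Es Eu \<longleftrightarrow>
     continuous_subbundle X A Es \<and> continuous_subbundle X A Eu \<and>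
     (\<forall>p\<in>topspace X. \<forall>v\<in>tangent_space A p.
        \<exists>!(u, w). u \<in> Es p \<and> w \<in> Eu p \<and> v = (\<lambda>c. u c + w c))"

definition anosov_diffeomorphism ::
  "'a topology \<Rightarrow> ('a, 'b::euclidean_space) chart set \<Rightarrow> ('a \<Rightarrow> 'a) \<Rightarrow> bool" where
  "anosov_diffeomorphism X A g \<longleftrightarrow>
     compact_manifold X A \<and> diffeomorphism X A g \<and>
     (\<exists>Es Eu m C lam.
        continuous_splitting X A Es Eu \<and>
        (\<forall>p\<in>topspace X. differential A g p ` Es p = Es (g p) \<and>
                        differential A g p ` Eu p = Eu (g p)) \<and>
        riemannian_metric X A m \<and> C > 0 \<and> 0 < lam \<and> lam < 1 \<and>
        (\<forall>k::nat. k \<ge> 1 \<longrightarrow> (\<forall>p\<in>topspace X.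
           (let nrm = (\<lambda>q v. sqrt (m q v v)); f = g ^^ k; f' = inv_into (topspace X) g ^^ k in
             (\<forall>v\<in>Es p. nrm (f p) (differential A f p v) \<le> C * lam ^ k * nrm p v) \<and>
             (\<forall>v\<in>Eu p. nrm (f' p) (differential A f' p v) \<le> C * lam ^ k * nrm p v)))))"

definition topologically_conjugate ::
  "'a topology \<Rightarrow> ('a \<Rightarrow> 'a) \<Rightarrow> 'b topology \<Rightarrow> ('b \<Rightarrow> 'b) \<Rightarrow> bool" where
  "topologically_conjugate X f1 Y f2 \<longleftrightarrow>
     (\<exists>h. homeomorphic_map X Y h \<and> (\<forall>x\<in>topspace X. h (f1 x) = f2 (h x)))"


section \<open>Affine groups and their orbit spaces\<close>

type_synonym 'n aff = "(real, 'n) vec \<times> ((real, 'n) vec, 'n) vec"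

definition affine_group :: "'n::finite aff monoid" where
  "affine_group = \<lparr>carrier = {(v, B). invertible B},
     monoid.mult = (\<lambda>(v, B) (w, D). (v + B *v w, B ** D)), one = (0, mat 1)\<rparr>"

text \<open>The subgroup of the affine group with linear parts in \<open>F\<close>, for a matrix group \<open>F\<close>.\<close>

definition semidirect :: "(real^'n^'n) set \<Rightarrow> 'n::finite aff monoid" where
  "semidirect F = affine_group\<lparr>carrier := UNIV \<times> F\<rparr>"

definition act :: "'n::finite aff \<Rightarrow> real^'n \<Rightarrow> real^'n" where
  "act g x = fst g + snd g *v x"

definition orbit :: "'n::finite aff set \<Rightarrow> real^'n \<Rightarrow> (real^'n) set" where
  "orbit \<Gamma> v = (\<lambda>g. act g v) ` \<Gamma>"

definition quotient_topology :: "'a topology \<Rightarrow> ('a \<Rightarrow> 'b) \<Rightarrow> 'b topology" where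
  "quotient_topology X q =
     topology (\<lambda>U. U \<subseteq> q ` topspace X \<and> openin X {x \<in> topspace X. q x \<in> U})"

definition orbit_space :: "'n::finite aff set \<Rightarrow> (real^'n) set topology" where
  "orbit_space \<Gamma> = quotient_topology euclidean (orbit \<Gamma>)"

text \<open>The smooth structure on the orbit space of a group acting freely and properly
  discontinuously: the charts are the local inverses of the projection.\<close>

definition orbit_atlas ::
  "'n::finite aff set \<Rightarrow> ((real^'n) set, real^'n) chart set" where
  "orbit_atlas \<Gamma> =
     {(orbit \<Gamma> ` V, inv_into V (orbit \<Gamma>)) | V. open V \<and> inj_on (orbit \<Gamma>) V}"

text \<open>Applied to an orbit, this is a single orbit exactly when \<open>\<phi>\<close> descends at that
  orbit.\<close>

definition induced_map ::
  "'n::finite aff set \<Rightarrow> (real^'n \<Rightarrow> real^'n) \<Rightarrow> (real^'n) set \<Rightarrow> (real^'n) set" where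
  "induced_map \<Gamma> \<phi> P = (\<Union>v\<in>P. orbit \<Gamma> (\<phi> v))"

definition torsion_free :: "('a, 'm) monoid_scheme \<Rightarrow> 'a set \<Rightarrow> bool" where
  "torsion_free G H \<longleftrightarrow>
     (\<forall>h\<in>H. \<forall>n::nat. n > 0 \<and> h [^]\<^bsub>G\<^esub> n = \<one>\<^bsub>G\<^esub> \<longrightarrow> h = \<one>\<^bsub>G\<^esub>)"

definition uniform_subgroup ::
  "('a::topological_space, 'm) monoid_scheme \<Rightarrow> 'a set \<Rightarrow> bool" where
  "uniform_subgroup G H \<longleftrightarrow>
     compact_space (quotient_topology (top_of_set (carrier G)) (\<lambda>g. H #>\<^bsub>G\<^esub> g))"

text \<open>For finite \<open>F\<close>, the Lie group \<open>semidirect F\<close> is the disjoint union of the open pieces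
  \<open>UNIV \<times> {B}\<close> with \<open>B \<in> F\<close>, so smoothness is smoothness on each of them.\<close>

definition lie_group_automorphism ::
  "(real^'n^'n) set \<Rightarrow> ('n::finite aff \<Rightarrow> 'n::finite aff) \<Rightarrow> bool" where
  "lie_group_automorphism F \<phi> \<longleftrightarrow> \<phi> \<in> iso (semidirect F) (semidirect F) \<and>
     (\<forall>B\<in>F. smooth_on UNIV (\<lambda>v. \<phi> (v, B)) \<and>
            smooth_on UNIV (\<lambda>v. inv_into (UNIV \<times> F) \<phi> (v, B)))"

definition infranil_automorphism ::
  "'n::finite aff set \<Rightarrow> (real^'n^'n) set
     \<Rightarrow> ((real^'n) set \<Rightarrow> (real^'n) set) \<Rightarrow> bool" where
  "infranil_automorphism \<Gamma> F g \<longleftrightarrow>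
     (\<exists>\<phi>. lie_group_automorphism F \<phi> \<and> \<phi> ` ({0} \<times> F) = {0} \<times> F \<and> \<phi> ` \<Gamma> = \<Gamma> \<and>
        (\<forall>v. g (orbit \<Gamma> v) = orbit \<Gamma> (fst (\<phi> (v, mat 1)))))"


section \<open>The concrete group and map\<close>

definition L :: "real^4^4" where
  "L = vector [vector [-1, 0, 0, 0], vector [0, -1, 0, 0], vector [0, 0, 1, 0], vector [0, 0, 0, 1]]"

definition F :: "(real^4^4) set" where
  "F = {mat 1, L}"

definition \<Gamma> :: "4 aff set" where
  "\<Gamma> = generate affine_group
     {(axis 1 1, mat 1), (axis 2 1, mat 1), (axis 3 1, mat 1), (axis 4 1, mat 1),
      (vector [0, 0, 1/2, 1/2], L)}"

definition \<alpha> :: "4 aff" where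
  "\<alpha> = (vector [1/2, 1/2, 0, 0],
     vector [vector [13, 8, 0, 0], vector [8, 5, 0, 0], vector [0, 0, 13, 8], vector [0, 0, 8, 5]])"


section \<open>Consistency checks\<close>

lemma group_affine_group: "group (affine_group :: 'n::finite aff monoid)"
proof (rule groupI)
  fix x assume "x \<in> carrier (affine_group :: 'n::finite aff monoid)"
  then obtain v and B :: "real^'n^'n" where x: "x = (v, B)" and B: "invertible B"
    by (auto simp: affine_group_def)
  obtain D where D: "B ** D = mat 1" "D ** B = mat 1"
    using B by (auto simp: invertible_def)
  have "(- (D *v v), D) \<in> carrier affine_group"
    using D by (auto simp: affine_group_def invertible_def)
  moreover have "(- (D *v v), D) \<otimes>\<^bsub>affine_group\<^esub> x = \<one>\<^bsub>affine_group\<^esub>"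
    by (simp add: affine_group_def x D)
  ultimately show "\<exists>y\<in>carrier affine_group. y \<otimes>\<^bsub>affine_group\<^esub> x = \<one>\<^bsub>affine_group\<^esub>"
    by blast
qed (auto simp: affine_group_def invertible_mult matrix_vector_right_distrib
       matrix_vector_mul_assoc matrix_mul_assoc add.assoc, auto simp: invertible_def)

lemma act_mult: "act (g \<otimes>\<^bsub>affine_group\<^esub> h) x = act g (act h x)"
  by (cases g; cases h) (simp add: act_def affine_group_def matrix_vector_right_distrib
       matrix_vector_mul_assoc add.assoc)

lemma openin_quotient_topology:
  "openin (quotient_topology X q) U \<longleftrightarrow>
     U \<subseteq> q ` topspace X \<and> openin X {x \<in> topspace X. q x \<in> U}"
proof -
  have eq1: "{x \<in> topspace X. q x \<in> S \<inter> T} =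
      {x \<in> topspace X. q x \<in> S} \<inter> {x \<in> topspace X. q x \<in> T}" for S T
    by auto
  have eq2: "{x \<in> topspace X. q x \<in> \<Union>K} = (\<Union>S\<in>K. {x \<in> topspace X. q x \<in> S})" for K
    by auto
  have "istopology (\<lambda>U. U \<subseteq> q ` topspace X \<and> openin X {x \<in> topspace X. q x \<in> U})"
    unfolding istopology_def eq1 eq2 by (auto intro!: openin_Union)
  then show ?thesis
    by (simp add: quotient_topology_def)
qed

lemma vector_4:
  "(vector [x, y, z, t] :: 'a::zero^4) $ 1 = x"
  "(vector [x, y, z, t] :: 'a::zero^4) $ 2 = y"
  "(vector [x, y, z, t] :: 'a::zero^4) $ 3 = z"
  "(vector [x, y, z, t] :: 'a::zero^4) $ 4 = t"
  by (simp_all add: vector_def)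

lemma act_alpha:
  "act \<alpha> (vector [x, y, z, t]) =
     vector [13 * x + 8 * y + 1/2, 8 * x + 5 * y + 1/2, 13 * z + 8 * t, 8 * z + 5 * t]"
  by (simp add: act_def \<alpha>_def vec_eq_iff matrix_vector_mult_def forall_4 sum_4 vector_4)

lemma alpha_in_affine_group: "\<alpha> \<in> carrier affine_group"
proof -
  let ?D = "vector [vector [5, -8, 0, 0], vector [-8, 13, 0, 0], vector [0, 0, 5, -8],
              vector [0, 0, -8, 13]] :: real^4^4"
  have "snd \<alpha> ** ?D = mat 1 \<and> ?D ** snd \<alpha> = mat 1"
    by (simp add: \<alpha>_def vec_eq_iff matrix_matrix_mult_def mat_def forall_4 sum_4 vector_4)
  then have "invertible (snd \<alpha>)"
    unfolding invertible_def by blast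
  then show ?thesis
    by (simp add: affine_group_def split: prod.split)
      (metis prod.collapse snd_conv)
qed

end

theory Submission
  imports Defs
begin

text \<open>The map \<open>\<alpha>\<close> normalises \<open>\<Gamma>\<close>, which consists of the integer translations and of the screw
  motions \<open>(v, L)\<close> whose translation part is integral in the first two coordinates and half-integral
  in the last two. The group acts by isometries and displaces every point by at least \<open>1/2\<close>, so the
  quotient is a compact flat manifold. Its tangent bundle pulls back to the
  trivial bundle on \<open>\<real>\<^sup>4\<close> (lemmas \<open>tangent_space_orbit\<close>, \<open>differential_push\<close>), where the differential of the
  induced map is the linear part of \<open>\<alpha>\<close>. That matrix is symmetric with eigenvalues the sixth powers of the
  golden ratio and of its inverse, and its eigenspaces are invariant under \<open>L\<close>; so they descend to an
  Anosov splitting (\<open>anosov_induced_map\<close>).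

  For the negative part, a topological conjugacy lifts to a homeomorphism of \<open>\<real>\<^sup>4\<close> that
  normalises \<open>\<Gamma>\<close> and intertwines \<open>\<alpha>\<close> with the lifted automorphism up to a deck transformation
  (\<open>lift_conjugacy\<close>). Hence conjugation by \<open>\<alpha>\<close> and the given automorphism act on \<open>\<Gamma>\<close> in the same way up to
  an automorphism of \<open>\<Gamma>\<close> and inner automorphisms. The automorphism sends the screw motion with translation part
  \<open>(0, 0, 1/2, 1/2)\<close> to itself times a central translation. Conjugation by \<open>\<alpha>\<close>, however, moves the first
  coordinate of the translation part of any element
  outside the lattice by an odd number, while inner automorphisms and central factors move it by even numbers only (\<open>not_conjugate\<close>).

  The lifting argument uses that the quotient embeds into a normed space by sending an orbit to its
  distance function (\<open>covering_dist_fun\<close>); the projection becomes a covering map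
  onto its image, and maps of the contractible space \<open>\<real>\<^sup>4\<close> lift through it.\<close>

section \<open>Affine maps and orbit spaces\<close>

abbreviation amult (infixl "\<star>" 70) where "g \<star> h \<equiv> g \<otimes>\<^bsub>affine_group\<^esub> h"
abbreviation ainv where "ainv g \<equiv> inv\<^bsub>affine_group\<^esub> g"
abbreviation aone where "aone \<equiv> \<one>\<^bsub>affine_group\<^esub>"

lemma act_one [simp]: "act aone x = x"
  by (simp add: act_def affine_group_def)

lemma fst_amult: "fst (g \<star> h) = act g (fst h)"
  by (cases g; cases h) (simp add: act_def affine_group_def)

lemma snd_amult: "snd (g \<star> h) = snd g ** snd h"
  by (cases g; cases h) (simp add: affine_group_def)

lemma act_diff: "act g x - act g y = snd g *v (x - y)"
  by (simp add: act_def matrix_vector_mult_diff_distrib)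

lemma continuous_on_act [continuous_intros]:
  assumes "continuous_on S f"
  shows "continuous_on S (\<lambda>x. act g (f x))"
  unfolding act_def by (intro continuous_intros bounded_linear.continuous_on[OF matrix_vector_mul_bounded_linear assms])

lemma act_ext:
  assumes "\<And>x. act g x = act h x"
  shows "g = h"
proof (rule prod_eqI)
  show f: "fst g = fst h" using assms[of 0] by (simp add: act_def)
  show "snd g = snd h" using assms f by (simp add: act_def matrix_eq)
qed

lemma act_ainv [simp]:
  assumes "g \<in> carrier affine_group"
  shows "act (ainv g) (act g x) = x" "act g (act (ainv g) x) = x"
  using group.l_inv[OF group_affine_group assms] group.r_inv[OF group_affine_group assms]
  by (metis act_mult act_one)+

lemma snd_ainv [simp]:
  assumes "g \<in> carrier affine_group"
  shows "snd (ainv g) *v (snd g *v x) = x" "snd g *v (snd (ainv g) *v x) = x"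
proof -
  have "snd (ainv g) *v (snd g *v x) = act (ainv g) (act g x) - act (ainv g) (act g 0)"
    by (simp only: act_diff) (simp add: act_def)
  then show "snd (ainv g) *v (snd g *v x) = x" using assms by simp
  have "snd g *v (snd (ainv g) *v x) = act g (act (ainv g) x) - act g (act (ainv g) 0)"
    by (simp only: act_diff) (simp add: act_def)
  then show "snd g *v (snd (ainv g) *v x) = x" using assms by simp
qed

lemma openin_orbit_space:
  "openin (orbit_space G) U \<longleftrightarrow> U \<subseteq> range (orbit G) \<and> open {x. orbit G x \<in> U}"
  by (simp add: orbit_space_def openin_quotient_topology)

lemma topspace_orbit_space [simp]: "topspace (orbit_space G) = range (orbit G)"
proof
  show "topspace (orbit_space G) \<subseteq> range (orbit G)"
    using openin_topspace openin_orbit_space by blast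
  have "openin (orbit_space G) (range (orbit G))"
    by (simp add: openin_orbit_space)
  then show "range (orbit G) \<subseteq> topspace (orbit_space G)"
    by (rule openin_subset)
qed

lemma continuous_map_orbit: "continuous_map euclidean (orbit_space G) (orbit G)"
  by (auto simp: continuous_map_def openin_orbit_space)

lemma continuous_map_from_orbit_space:
  "continuous_map (orbit_space G) Y f \<longleftrightarrow> continuous_map euclidean Y (\<lambda>x. f (orbit G x))"
proof -
  have "openin (orbit_space G) {P \<in> range (orbit G). f P \<in> U} \<longleftrightarrow> open {x. f (orbit G x) \<in> U}" for U
  proof -
    have "{x. orbit G x \<in> {P \<in> range (orbit G). f P \<in> U}} = {x. f (orbit G x) \<in> U}" by blast
    then show ?thesis unfolding openin_orbit_space by auto
  qed
  then show ?thesis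
    by (auto simp: continuous_map_def)
qed

section \<open>Groups of isometries acting freely and cocompactly\<close>

text \<open>A torsion free crystallographic group, described by its action. Discreteness and freeness are
  merged into one quantitative condition: a nontrivial element displaces every point by at least
  \<open>\<epsilon>\<close>. Balls of radius \<open>\<epsilon> / 2\<close> are then evenly covered, at every point alike.\<close>

locale deck_group =
  fixes G :: "'n::finite aff set" and \<epsilon> :: real
  assumes subgroup: "subgroup G affine_group"
    and orthogonal: "g \<in> G \<Longrightarrow> orthogonal_matrix (snd g)"
    and \<epsilon>_pos: "\<epsilon> > 0"
    and displacement: "\<lbrakk>g \<in> G; g \<noteq> aone\<rbrakk> \<Longrightarrow> \<epsilon> \<le> dist (act g x) x"
    and cocompact: "\<exists>R. \<forall>x. \<exists>g\<in>G. norm (act g x) \<le> R"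
begin

lemma mem_carrier: "g \<in> G \<Longrightarrow> g \<in> carrier affine_group"
  using subgroup subgroup.subset by blast

lemma mult_mem: "g \<in> G \<Longrightarrow> h \<in> G \<Longrightarrow> g \<star> h \<in> G"
  by (rule subgroup.m_closed[OF subgroup])

lemma inv_mem: "g \<in> G \<Longrightarrow> ainv g \<in> G"
  by (rule subgroup.m_inv_closed[OF subgroup])

lemma one_mem: "aone \<in> G"
  by (rule subgroup.one_closed[OF subgroup])

lemma act_inv [simp]:
  assumes "g \<in> G"
  shows "act (ainv g) (act g x) = x" "act g (act (ainv g) x) = x"
  by (rule act_ainv[OF mem_carrier[OF assms]])+

lemma norm_linear_part: "g \<in> G \<Longrightarrow> norm (snd g *v x) = norm x"
  using orthogonal orthogonal_transformation_matrix orthogonal_transformation_norm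
  by (metis matrix_of_matrix_vector_mul matrix_vector_mul_linear)

lemma dist_act [simp]: "g \<in> G \<Longrightarrow> dist (act g x) (act g y) = dist x y"
  by (simp add: dist_norm act_diff norm_linear_part)

text \<open>Two elements that agree up to an error below \<open>\<epsilon>\<close> at a single point are equal; this is what makes
  choices of group elements locally constant in everything that follows.\<close>

lemma act_separated:
  assumes "g \<in> G" "h \<in> G" "dist (act g x) (act h x) < \<epsilon>"
  shows "g = h"
proof -
  have "dist (act (ainv h \<star> g) x) x = dist (act (ainv h) (act g x)) (act (ainv h) (act h x))"
    using assms by (simp add: act_mult)
  also have "\<dots> < \<epsilon>"
    using assms dist_act[OF inv_mem[OF assms(2)]] by metis
  finally have "ainv h \<star> g = aone"
    using displacement[of "ainv h \<star> g" x] assms by (auto simp: mult_mem inv_mem)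
  then have "act g x = act h x" for x
    by (metis act_inv(2) act_mult act_one assms(2))
  then show ?thesis by (rule act_ext)
qed

lemma act_cancel: "\<lbrakk>g \<in> G; h \<in> G; act g x = act h x\<rbrakk> \<Longrightarrow> g = h"
  using act_separated[of g h x] \<epsilon>_pos by simp

lemma mem_orbit_iff: "y \<in> orbit G x \<longleftrightarrow> (\<exists>g\<in>G. y = act g x)"
  by (auto simp: orbit_def)

lemma orbit_act [simp]:
  assumes "g \<in> G" shows "orbit G (act g x) = orbit G x"
proof -
  have "act h (act g x) \<in> orbit G x" if "h \<in> G" for h
    using that assms by (metis act_mult mem_orbit_iff mult_mem)
  moreover have "act h x \<in> orbit G (act g x)" if "h \<in> G" for h
    using that assms by (metis act_inv(1) act_mult inv_mem mem_orbit_iff mult_mem)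
  ultimately show ?thesis
    by (auto simp: mem_orbit_iff)
qed

lemma self_mem_orbit: "x \<in> orbit G x"
  using one_mem mem_orbit_iff by force

lemma orbit_eq_iff: "orbit G x = orbit G y \<longleftrightarrow> (\<exists>g\<in>G. y = act g x)"
  by (metis mem_orbit_iff orbit_act self_mem_orbit)

lemma open_saturation:
  assumes "open V"
  shows "open {x. orbit G x \<in> orbit G ` V}"
proof -
  have eq: "{x. orbit G x \<in> orbit G ` V} = (\<Union>g\<in>G. act g -` V)"
  proof (intro subset_antisym subsetI)
    fix x assume "x \<in> {x. orbit G x \<in> orbit G ` V}"
    then obtain v where "v \<in> V" "orbit G x = orbit G v" by blast
    then show "x \<in> (\<Union>g\<in>G. act g -` V)" using orbit_eq_iff by auto
  next
    fix x assume "x \<in> (\<Union>g\<in>G. act g -` V)"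
    then obtain g where "g \<in> G" "act g x \<in> V" by blast
    then show "x \<in> {x. orbit G x \<in> orbit G ` V}" by (metis imageI mem_Collect_eq orbit_act)
  qed
  show ?thesis
    unfolding eq by (intro open_UN ballI open_vimage assms continuous_intros)
qed

lemma openin_orbit_image: "open V \<Longrightarrow> openin (orbit_space G) (orbit G ` V)"
  by (auto simp: openin_orbit_space open_saturation)

lemma compact_orbit_space: "compact_space (orbit_space G)"
proof -
  obtain R where R: "\<forall>x. \<exists>g\<in>G. norm (act g x) \<le> R" using cocompact by blast
  have "range (orbit G) = orbit G ` cball 0 R"
  proof (intro subset_antisym subsetI)
    fix P assume "P \<in> range (orbit G)"
    then obtain x where "P = orbit G x" by blast
    moreover obtain g where "g \<in> G" "norm (act g x) \<le> R" using R by blast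
    ultimately show "P \<in> orbit G ` cball 0 R"
      by (intro image_eqI[of _ _ "act g x"]) auto
  qed auto
  moreover have "compactin (orbit_space G) (orbit G ` cball 0 R)"
    by (rule image_compactin[OF _ continuous_map_orbit]) auto
  ultimately show ?thesis
    by (simp add: compact_space_def)
qed

lemma second_countable_orbit_space: "second_countable (orbit_space G)"
proof (rule second_countable_open_map_image)
  show "second_countable (euclidean :: (real^'n) topology)"
  proof -
    obtain \<B> :: "(real^'n) set set" where \<B>: "countable \<B>" "\<And>C. C \<in> \<B> \<Longrightarrow> open C"
      "\<And>S. open S \<Longrightarrow> \<exists>U. U \<subseteq> \<B> \<and> S = \<Union>U"
      using univ_second_countable by blast
    have "\<exists>U\<in>\<B>. x \<in> U \<and> U \<subseteq> S" if "open S" "x \<in> S" for S x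
      using \<B>(3)[OF that(1)] that(2) by blast
    then show ?thesis
      unfolding second_countable_def using \<B>(1,2) by (intro exI[of _ \<B>]) auto
  qed
qed (use openin_orbit_image in \<open>auto simp: continuous_map_orbit open_map_def\<close>)

lemma inj_on_orbit_ball: "inj_on (orbit G) (ball x (\<epsilon> / 2))"
proof (rule inj_onI)
  fix y z assume yz: "y \<in> ball x (\<epsilon> / 2)" "z \<in> ball x (\<epsilon> / 2)" "orbit G y = orbit G z"
  then obtain h where h: "h \<in> G" "z = act h y"
    using orbit_eq_iff by metis
  have "dist z y \<le> dist x z + dist x y" by (rule dist_triangle3)
  then have "dist (act h y) y < \<epsilon>" using yz(1,2) h by auto
  then have "h = aone" using displacement[of h y] h(1) by force
  then show "y = z" using h by simp
qed

text \<open>An orbit is represented by its distance function. This realises the orbit space as a subset of the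
  normed space of bounded continuous functions, where the lifting theorems for covering maps of
  normed spaces apply, and makes the Hausdorff property evident.\<close>

definition dist_fun :: "(real^'n) set \<Rightarrow> (real^'n) \<Rightarrow>\<^sub>C real" where
  "dist_fun P = Bcontfun (\<lambda>z. infdist z P)"

lemma dist_fun_apply: "apply_bcontfun (dist_fun (orbit G x)) z = infdist z (orbit G x)"
proof -
  obtain R where R: "\<And>x. \<exists>g\<in>G. norm (act g x) \<le> R" using cocompact by blast
  have "norm (infdist z (orbit G x)) \<le> 2 * R" for z
  proof -
    obtain g h where gh: "g \<in> G" "h \<in> G" "norm (act g z) \<le> R" "norm (act h x) \<le> R"
      using R by metis
    have "infdist z (orbit G x) \<le> dist z (act (ainv g) (act h x))"
      by (rule infdist_le) (metis act_mult gh inv_mem mem_orbit_iff mult_mem)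
    also have "\<dots> = dist (act g z) (act h x)"
      using gh by (metis act_inv(2) dist_act)
    also have "\<dots> \<le> 2 * R"
      using gh norm_triangle_ineq4[of "act g z" "act h x"] by (simp add: dist_norm)
    finally show ?thesis by (simp add: infdist_nonneg)
  qed
  then have "(\<lambda>z. infdist z (orbit G x)) \<in> bcontfun"
    by (intro bcontfun_normI continuous_intros)
  then show ?thesis
    by (simp add: dist_fun_def Bcontfun_inverse)
qed

lemma infdist_orbit_less:
  "infdist x (orbit G y) < r \<longleftrightarrow> (\<exists>g\<in>G. dist x (act g y) < r)"
proof -
  have ne: "orbit G y \<noteq> {}" using self_mem_orbit by blast
  have "infdist x (orbit G y) = (INF a\<in>orbit G y. dist x a)"
    using ne by (simp add: infdist_def)
  moreover have "(INF a\<in>orbit G y. dist x a) < r \<longleftrightarrow> (\<exists>a\<in>orbit G y. dist x a < r)"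
    by (rule cINF_less_iff[OF ne]) (auto intro: bdd_belowI[of _ 0])
  ultimately show ?thesis
    by (auto simp: orbit_def)
qed

text \<open>The group acts by isometries, so moving a point by \<open>d\<close> moves every point of its orbit
  by \<open>d\<close>; hence the representation is 1-Lipschitz.\<close>

lemma dist_dist_fun_le: "dist (dist_fun (orbit G x)) (dist_fun (orbit G y)) \<le> dist x y"
proof (rule dist_bound)
  have *: "infdist z (orbit G x) \<le> infdist z (orbit G y) + dist x y" for x y z
  proof (rule ccontr)
    assume "\<not> ?thesis"
    then have "infdist z (orbit G y) < infdist z (orbit G x) - dist x y" by simp
    then obtain g where g: "g \<in> G" "dist z (act g y) < infdist z (orbit G x) - dist x y"
      by (auto simp: infdist_orbit_less)
    have "dist z (act g x) \<le> dist z (act g y) + dist (act g y) (act g x)"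
      by (rule dist_triangle)
    then have "dist z (act g x) < infdist z (orbit G x)"
      using g by (simp add: dist_commute)
    moreover have "infdist z (orbit G x) \<le> dist z (act g x)"
      by (rule infdist_le) (use g mem_orbit_iff in blast)
    ultimately show False by simp
  qed
  fix z
  show "dist (dist_fun (orbit G x) z) (dist_fun (orbit G y) z) \<le> dist x y"
    using *[of z x y] *[of z y x] by (simp add: dist_fun_apply dist_real_def dist_commute abs_le_iff)
qed

text \<open>Evaluating both distance functions at \<open>x\<close> itself recovers the distance of \<open>x\<close> from the other orbit;
  so small balls map exactly onto relative balls.\<close>

lemma dist_fun_close:
  assumes "dist (dist_fun (orbit G x)) (dist_fun (orbit G y)) < r"
  shows "\<exists>g\<in>G. dist x (act g y) < r"
proof -
  have "infdist x (orbit G y) = dist (dist_fun (orbit G x) x) (dist_fun (orbit G y) x)"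
    by (simp add: dist_fun_apply self_mem_orbit infdist_nonneg)
  also have "\<dots> < r"
    using assms dist_bounded le_less_trans by blast
  finally show ?thesis by (simp add: infdist_orbit_less)
qed

text \<open>If a vanishing distance were not attained, two different points of one orbit would lie within
  \<open>\<epsilon>\<close> of each other.\<close>

lemma dist_fun_inj:
  assumes "dist_fun (orbit G x) = dist_fun (orbit G y)"
  shows "orbit G x = orbit G y"
proof -
  obtain g where g: "g \<in> G" "dist x (act g y) < \<epsilon> / 2"
    using dist_fun_close[of x y "\<epsilon> / 2"] assms \<epsilon>_pos by auto
  show ?thesis
  proof (rule ccontr)
    assume ne: "orbit G x \<noteq> orbit G y"
    have "dist x (act g y) > 0"
      using ne g orbit_eq_iff by (metis zero_less_dist_iff orbit_act)
    then obtain h where h: "h \<in> G" "dist x (act h y) < dist x (act g y)"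
      using dist_fun_close[of x y "dist x (act g y)"] assms by auto
    have "dist (act g y) (act h y) \<le> dist x (act g y) + dist x (act h y)"
      by (rule dist_triangle3)
    then have "g = h" using g h by (intro act_separated[of g h y]) auto
    then show False using h by simp
  qed
qed

lemma continuous_dist_fun: "continuous_map (orbit_space G) euclidean dist_fun"
proof -
  have "continuous_on UNIV (\<lambda>x. dist_fun (orbit G x))"
    by (rule continuous_onI) (metis dist_commute dist_dist_fun_le le_less_trans less_imp_le)
  then show ?thesis
    by (simp add: continuous_map_from_orbit_space)
qed

lemma Hausdorff_orbit_space: "Hausdorff_space (orbit_space G)"
  by (rule Hausdorff_space_injective_preimage[OF Hausdorff_space_euclidean continuous_dist_fun])
     (auto intro!: inj_onI dest: dist_fun_inj)

lemma dist_fun_image_ball: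
  "(\<lambda>x. dist_fun (orbit G x)) ` ball x r =
   range (\<lambda>x. dist_fun (orbit G x)) \<inter> ball (dist_fun (orbit G x)) r"
proof -
  have "dist_fun (orbit G y) \<in> (\<lambda>x. dist_fun (orbit G x)) ` ball x r"
    if y: "dist (dist_fun (orbit G x)) (dist_fun (orbit G y)) < r" for y
  proof -
    obtain g where "g \<in> G" "dist x (act g y) < r"
      using dist_fun_close[OF y] by blast
    then show ?thesis
      by (intro image_eqI[of _ _ "act g y"]) auto
  qed
  then show ?thesis
    using dist_dist_fun_le le_less_trans by fastforce
qed

lemma dist_fun_open:
  assumes "open U"
  shows "openin (top_of_set (range (\<lambda>x. dist_fun (orbit G x)))) ((\<lambda>x. dist_fun (orbit G x)) ` U)"
proof (subst openin_subopen, intro ballI)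
  fix q assume "q \<in> (\<lambda>x. dist_fun (orbit G x)) ` U"
  then obtain x where x: "x \<in> U" "q = dist_fun (orbit G x)" by blast
  obtain r where r: "r > 0" "ball x r \<subseteq> U" using assms x(1) openE by blast
  show "\<exists>T. openin (top_of_set (range (\<lambda>x. dist_fun (orbit G x)))) T \<and> q \<in> T \<and>
            T \<subseteq> (\<lambda>x. dist_fun (orbit G x)) ` U"
  proof (intro exI conjI)
    show "openin (top_of_set (range (\<lambda>x. dist_fun (orbit G x)))) ((\<lambda>x. dist_fun (orbit G x)) ` ball x r)"
      unfolding dist_fun_image_ball by (simp add: openin_open_Int)
  qed (use x r in auto)
qed

text \<open>The sheets over the image of the ball of radius \<open>\<epsilon> / 2\<close> about \<open>x\<close> are its translates, which are
  disjoint because translates of \<open>x\<close> are \<open>\<epsilon>\<close> apart.\<close>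

lemma covering_dist_fun:
  "covering_space UNIV (\<lambda>x. dist_fun (orbit G x)) (range (\<lambda>x. dist_fun (orbit G x)))"
  (is "covering_space UNIV ?E ?S")
proof
  show cont: "continuous_on UNIV ?E"
    using continuous_dist_fun by (simp add: continuous_map_from_orbit_space)
  fix q assume "q \<in> ?S"
  then obtain x where q: "q = ?E x" by blast
  define r where "r = \<epsilon> / 2"
  have r: "r > 0" using \<epsilon>_pos by (simp add: r_def)
  define T where "T = ?E ` ball x r"
  define \<V> where "\<V> = (\<lambda>g. ball (act g x) r) ` G"
  have T: "openin (top_of_set ?S) T"
    unfolding T_def by (rule dist_fun_open) simp
  have E_act: "?E (act g y) = ?E y" if "g \<in> G" for g y using that by simp
  have im: "?E ` ball (act g x) r = T" if "g \<in> G" for g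
    unfolding T_def dist_fun_image_ball using that by simp
  have "\<Union>\<V> = ?E -` T"
  proof
    show "\<Union>\<V> \<subseteq> ?E -` T"
      using im unfolding \<V>_def by blast
    show "?E -` T \<subseteq> \<Union>\<V>"
    proof
      fix y assume "y \<in> ?E -` T"
      then have "dist (?E x) (?E y) < r"
        unfolding T_def dist_fun_image_ball by auto
      then obtain g where g: "g \<in> G" "dist x (act g y) < r"
        using dist_fun_close by blast
      then have "dist (act (ainv g) x) y < r"
        by (metis act_inv(1) dist_act inv_mem)
      then show "y \<in> \<Union>\<V>"
        using inv_mem[OF g(1)] by (force simp: \<V>_def)
    qed
  qed
  moreover have "pairwise disjnt \<V>"
  proof -
    have "g = h" if "g \<in> G" "h \<in> G" "dist (act g x) y < r" "dist (act h x) y < r" for g h y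
    proof -
      have "dist (act g x) (act h x) \<le> dist (act g x) y + dist (act h x) y"
        by (rule dist_triangle2)
      then show ?thesis using that by (intro act_separated[of g h x]) (auto simp: r_def)
    qed
    then show ?thesis
      unfolding \<V>_def pairwise_def disjnt_def by fastforce
  qed
  moreover have "\<exists>p. homeomorphism u T ?E p" if "u \<in> \<V>" for u
  proof -
    obtain g where g: "g \<in> G" "u = ball (act g x) r" using \<open>u \<in> \<V>\<close> by (auto simp: \<V>_def)
    show ?thesis
    proof (rule homeomorphism_injective_open_map)
      show "continuous_on u ?E" using cont continuous_on_subset by blast
      show "?E ` u = T" using im g by simp
      show "inj_on ?E u"
        using inj_on_orbit_ball[of "act g x"] unfolding g r_def
        by (auto simp: inj_on_def dest!: dist_fun_inj)
      fix W assume "openin (top_of_set u) W"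
      then have W: "open W" "W \<subseteq> u" using g openin_open_eq by auto
      then have "openin (top_of_set ?S) (?E ` W)" by (simp add: dist_fun_open)
      moreover have "?E ` W \<subseteq> T" "T \<subseteq> ?S"
        using image_mono[OF W(2), of ?E] im[OF g(1)] g(2) by (auto simp: T_def)
      ultimately show "openin (top_of_set T) (?E ` W)"
        by (meson openin_subset_trans)
    qed auto
  qed
  ultimately have "\<Union>\<V> = UNIV \<inter> ?E -` T \<and> (\<forall>u\<in>\<V>. openin (top_of_set UNIV) u) \<and>
      pairwise disjnt \<V> \<and> (\<forall>u\<in>\<V>. \<exists>p. homeomorphism u T ?E p)"
    by (auto simp: \<V>_def)
  then show "\<exists>T. q \<in> T \<and> openin (top_of_set ?S) T \<and> (\<exists>v. \<Union>v = UNIV \<inter> ?E -` T \<and>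
      (\<forall>u\<in>v. openin (top_of_set UNIV) u) \<and> pairwise disjnt v \<and> (\<forall>u\<in>v. \<exists>p. homeomorphism u T ?E p))"
    using T q r by (intro exI[of _ T] conjI exI[of _ \<V>]) (auto simp: T_def)
qed simp

text \<open>Euclidean space is contractible, so a map from it into the orbit space is null-homotopic and lifts
  through the covering.\<close>

lemma lift_exists:
  fixes H :: "real^'n \<Rightarrow> (real^'n) set"
  assumes "continuous_map euclidean (orbit_space G) H"
  obtains k where "continuous_on UNIV k" "\<And>x. orbit G (k x) = H x"
proof -
  let ?E = "\<lambda>x. dist_fun (orbit G x)"
  have H: "H x \<in> range (orbit G)" for x
    using continuous_map_funspace[OF assms] by auto
  have "continuous_map euclidean euclidean (dist_fun \<circ> H)"
    using assms continuous_dist_fun by (rule continuous_map_compose)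
  then have cont: "continuous_on UNIV (\<lambda>x. dist_fun (H x))" by (simp add: o_def)
  have im: "(\<lambda>x. dist_fun (H x)) \<in> UNIV \<rightarrow> range ?E"
  proof
    fix x
    obtain y where "H x = orbit G y" using H by blast
    then show "dist_fun (H x) \<in> range ?E" by simp
  qed
  obtain c where "homotopic_with_canon (\<lambda>h. True) UNIV (range ?E) (\<lambda>x. dist_fun (H x)) (\<lambda>x. c)"
    using nullhomotopic_from_contractible[OF cont im contractible_UNIV] by blast
  then obtain k where k: "continuous_on UNIV k" "\<And>x. ?E (k x) = dist_fun (H x)"
    using covering_space_lift_inessential_function[OF covering_dist_fun] by (metis UNIV_I)
  have "orbit G (k x) = H x" for x
  proof -
    obtain y where y: "H x = orbit G y" using H by blast
    then have "orbit G (k x) = orbit G y"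
      by (intro dist_fun_inj) (simp add: k(2))
    then show ?thesis using y by simp
  qed
  with k(1) show thesis by (rule that)
qed

text \<open>The group element relating two lifts at a point is locally constant by the separation of orbits,
  hence constant.\<close>

lemma lifts_differ_by_deck:
  fixes k l :: "'a::real_normed_vector \<Rightarrow> real^'n"
  assumes cont: "continuous_on UNIV k" "continuous_on UNIV l"
    and eq: "\<And>x. orbit G (k x) = orbit G (l x)"
  obtains g where "g \<in> G" "\<And>x. k x = act g (l x)"
proof -
  have "\<exists>g. g \<in> G \<and> k x = act g (l x)" for x
    using eq[of x] orbit_eq_iff by metis
  then obtain g where g: "\<And>x. g x \<in> G \<and> k x = act (g x) (l x)" by metis
  have "g constant_on UNIV"
  proof (rule locally_constant_imp_constant)
    fix x :: 'a
    define T where "T = k -` ball (k x) (\<epsilon> / 2) \<inter> l -` ball (l x) (\<epsilon> / 2)"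
    have T: "open T" "x \<in> T"
      unfolding T_def using cont \<epsilon>_pos by (auto intro!: open_Int open_vimage)
    have loc: "g y = g x" if y: "y \<in> T" for y
    proof (rule act_separated)
      show "g y \<in> G" "g x \<in> G" using g by auto
      have "dist (act (g y) (l y)) (act (g x) (l y))
          \<le> dist (k y) (k x) + dist (act (g x) (l x)) (act (g x) (l y))"
        using g dist_triangle by metis
      also have "\<dots> < \<epsilon>"
        using y g by (simp add: T_def dist_commute)
      finally show "dist (act (g y) (l y)) (act (g x) (l y)) < \<epsilon>" .
    qed
    show "\<exists>T. openin (top_of_set UNIV) T \<and> x \<in> T \<and> (\<forall>y\<in>T. g y = g x)"
      by (intro exI[of _ T] conjI ballI loc) (use T in simp_all)
  qed (rule connected_UNIV)
  then obtain g0 where "\<And>x. g x = g0"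
    unfolding constant_on_def by blast
  then have "g0 \<in> G" "k x = act g0 (l x)" for x
    using g[of x] by auto
  then show thesis
    by (rule that)
qed

end

section \<open>Smoothness of locally affine maps\<close>

lemma has_derivative_locally_affine:
  assumes "bounded_linear B" "\<forall>\<^sub>F y in nhds x. f y = a + B y"
  shows "(f has_derivative B) (at x)"
proof (rule has_derivative_transform_eventually)
  show "((\<lambda>y. a + B y) has_derivative B) (at x)"
    using assms(1) by (auto intro!: derivative_eq_intros bounded_linear_imp_has_derivative)
  show "\<forall>\<^sub>F y in at x. a + B y = f y"
    using assms(2) by (auto simp: eventually_at_filter elim: eventually_mono)
  show "a + B x = f x"
    using eventually_nhds_x_imp_x[OF assms(2)] by simp
qed simp

text \<open>The class of locally affine maps is closed under differentiation in a fixed direction (the derivative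
  is locally constant), which is why the induction on the order of smoothness goes through.\<close>

lemma C_k_on_locally_affine:
  fixes f :: "'a::euclidean_space \<Rightarrow> 'b::real_normed_vector"
  assumes "\<And>x. x \<in> S \<Longrightarrow> \<exists>a B. bounded_linear B \<and> (\<forall>\<^sub>F y in nhds x. f y = a + B y)"
  shows "C_k_on k S f"
  using assms
proof (induction k arbitrary: f)
  case 0
  then have "f differentiable (at x)" if "x \<in> S" for x
    using that has_derivative_locally_affine differentiable_def by metis
  then show ?case
    by (simp add: continuous_at_imp_continuous_on differentiable_imp_continuous_within)
next
  case (Suc k)
  have "f differentiable (at x)" if "x \<in> S" for x
    using that Suc.prems has_derivative_locally_affine differentiable_def by metis
  moreover have "C_k_on k S (\<lambda>x. frechet_derivative f (at x) v)" for v
  proof (rule Suc.IH)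
    fix x assume "x \<in> S"
    then obtain a B where aB: "bounded_linear B" "\<forall>\<^sub>F y in nhds x. f y = a + B y"
      using Suc.prems by blast
    have "\<forall>\<^sub>F y in nhds x. \<forall>\<^sub>F z in nhds y. f z = a + B z"
      using aB(2) by (simp add: eventually_eventually)
    then have "\<forall>\<^sub>F y in nhds x. frechet_derivative f (at y) v = B v + 0"
      by eventually_elim (metis aB(1) add.right_neutral frechet_derivative_at has_derivative_locally_affine)
    then show "\<exists>a B. bounded_linear B \<and> (\<forall>\<^sub>F y in nhds x. frechet_derivative f (at y) v = a + B y)"
      using bounded_linear_zero by blast
  qed
  ultimately show ?case by simp
qed

text \<open>A basis of a subspace, indexed by an initial segment of the naturals and with coefficient
  sequences normalised to vanish beyond it, as required of local frames of a subbundle.\<close>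

lemma subspace_frame:
  fixes E :: "'a::euclidean_space set"
  assumes "subspace E"
  obtains k :: nat and b :: "nat \<Rightarrow> 'a" where "\<And>i. i < k \<Longrightarrow> b i \<in> E"
    "\<And>v. v \<in> E \<Longrightarrow> \<exists>!r. (\<forall>i\<ge>k. r i = 0) \<and> v = (\<Sum>i<k. r i *\<^sub>R b i)"
proof -
  obtain B where B: "B \<subseteq> E" "independent B" "E \<subseteq> span B"
    using basis_exists[of E] by metis
  have fin: "finite B" using B(2) by (rule independent_imp_finite)
  obtain b where b: "bij_betw b {0..<card B} B"
    using ex_bij_betw_nat_finite[OF fin] by blast
  define k where "k = card B"
  have b: "bij_betw b {..<k} B" using b by (simp add: k_def lessThan_atLeast0)
  have bE: "b i \<in> E" if "i < k" for i
    using that b B(1) by (auto simp: bij_betw_def)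
  have ind: "\<forall>i<k. r i = 0" if r: "(\<Sum>i<k. r i *\<^sub>R b i) = 0" for r :: "nat \<Rightarrow> real"
  proof -
    define u where "u w = r (inv_into {..<k} b w)" for w
    have u: "u (b i) = r i" if "i < k" for i
      using that b by (simp add: u_def bij_betw_def)
    have "(\<Sum>w\<in>B. u w *\<^sub>R w) = (\<Sum>i<k. u (b i) *\<^sub>R b i)"
      by (rule sum.reindex_bij_betw[OF b, symmetric])
    also have "\<dots> = 0" using r u by simp
    finally have "u w = 0" if "w \<in> B" for w
      using that B(2) fin independentD by blast
    then show ?thesis
      using u b by (metis bij_betw_apply lessThan_iff)
  qed
  have "\<exists>!r. (\<forall>i\<ge>k. r i = 0) \<and> v = (\<Sum>i<k. r i *\<^sub>R b i)" if "v \<in> E" for v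
  proof (rule ex_ex1I)
    have "v \<in> span B" using that B(3) by blast
    then obtain u where u: "v = (\<Sum>w\<in>B. u w *\<^sub>R w)"
      using span_finite[OF fin] by auto
    also have "\<dots> = (\<Sum>i<k. u (b i) *\<^sub>R b i)"
      by (rule sum.reindex_bij_betw[OF b, symmetric])
    finally show "\<exists>r. (\<forall>i\<ge>k. r i = 0) \<and> v = (\<Sum>i<k. r i *\<^sub>R b i)"
      by (intro exI[of _ "\<lambda>i. if i < k then u (b i) else 0"]) auto
  next
    fix r r' :: "nat \<Rightarrow> real"
    assume r: "(\<forall>i\<ge>k. r i = 0) \<and> v = (\<Sum>i<k. r i *\<^sub>R b i)"
      and r': "(\<forall>i\<ge>k. r' i = 0) \<and> v = (\<Sum>i<k. r' i *\<^sub>R b i)"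
    have "(\<Sum>i<k. (r i - r' i) *\<^sub>R b i) = 0"
      using r r' by (simp add: scaleR_diff_left sum_subtractf)
    then have "\<forall>i<k. r i = r' i" using ind[of "\<lambda>i. r i - r' i"] by simp
    then show "r = r'" using r r' by (metis ext leI)
  qed
  with bE show thesis by (rule that)
qed

section \<open>The smooth structure of the orbit space\<close>

primrec apow :: "'n::finite aff \<Rightarrow> nat \<Rightarrow> 'n aff" where
  "apow a 0 = aone"
| "apow a (Suc k) = a \<star> apow a k"

lemma snd_apow: "snd (apow a k) *v v = (((*v) (snd a)) ^^ k) v"
proof (induction k)
  case 0 show ?case by (simp add: affine_group_def)
next
  case (Suc k) then show ?case by (simp add: snd_amult flip: matrix_vector_mul_assoc)
qed

context deck_group
begin

lemma chartE:
  assumes "c \<in> orbit_atlas G"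
  obtains V where "open V" "inj_on (orbit G) V" "fst c = orbit G ` V" "snd c ` fst c = V"
    "\<And>y. y \<in> V \<Longrightarrow> param c y = orbit G y" "\<And>y. y \<in> V \<Longrightarrow> snd c (orbit G y) = y"
proof -
  obtain V where V: "open V" "inj_on (orbit G) V" "c = (orbit G ` V, inv_into V (orbit G))"
    using assms by (auto simp: orbit_atlas_def)
  have inv: "inv_into V (orbit G) (orbit G y) = y" if "y \<in> V" for y
    using that V(2) by simp
  have "inj_on (inv_into V (orbit G)) (orbit G ` V)"
    by (simp add: inj_on_inv_into)
  then have par: "param c y = orbit G y" if "y \<in> V" for y
    unfolding V(3) fst_conv snd_conv by (rule inv_into_f_eq) (use that inv in simp_all)
  show thesis
    by (rule that[of V]) (use V inv par in \<open>auto simp: image_image\<close>)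
qed

lemma chart_inverse:
  assumes "c \<in> orbit_atlas G" "p \<in> fst c"
  shows "orbit G (snd c p) = p" "param c (snd c p) = p"
  using assms by (metis chartE imageE)+

lemma ball_chart: 
  shows "(orbit G ` ball x (\<epsilon> / 2), inv_into (ball x (\<epsilon> / 2)) (orbit G)) \<in> charts_at (orbit_atlas G) (orbit G x)"
  unfolding charts_at_def orbit_atlas_def using inj_on_orbit_ball \<epsilon>_pos by auto

lemma some_chart: "(SOME c. c \<in> charts_at (orbit_atlas G) (orbit G x)) \<in> charts_at (orbit_atlas G) (orbit G x)"
  using ball_chart someI by metis

text \<open>The sheet that a chart selects over \<open>x\<close>, named by a deck transformation. Derivatives of
  coordinate changes are quotients of the linear parts of two sheets.\<close>

definition deck :: "((real^'n) set, real^'n) chart \<Rightarrow> real^'n \<Rightarrow> 'n aff" where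
  "deck c x = (THE g. g \<in> G \<and> snd c (orbit G x) = act g x)"

lemma deck:
  assumes "c \<in> charts_at (orbit_atlas G) (orbit G x)"
  shows "deck c x \<in> G" "snd c (orbit G x) = act (deck c x) x"
proof -
  have "orbit G x = orbit G (snd c (orbit G x))"
    using assms chart_inverse by (simp add: charts_at_def)
  then obtain g where "g \<in> G" "snd c (orbit G x) = act g x"
    using orbit_eq_iff by blast
  then have "\<exists>!g. g \<in> G \<and> snd c (orbit G x) = act g x"
    using act_cancel by metis
  from theI'[OF this] show "deck c x \<in> G" "snd c (orbit G x) = act (deck c x) x"
    by (simp_all add: deck_def)
qed

lemma deck_act:
  assumes "c \<in> charts_at (orbit_atlas G) (orbit G x)" "h \<in> G"
  shows "deck c (act h x) \<star> h = deck c x"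
proof (rule act_cancel)
  have c': "c \<in> charts_at (orbit_atlas G) (orbit G (act h x))" using assms by simp
  show "deck c (act h x) \<star> h \<in> G" "deck c x \<in> G"
    using deck(1)[OF c'] deck(1)[OF assms(1)] assms(2) mult_mem by auto
  show "act (deck c (act h x) \<star> h) x = act (deck c x) x"
    using deck(2)[OF c'] deck(2)[OF assms(1)] assms(2) by (simp add: act_mult)
qed

text \<open>A map of the orbit space that is covered by an affine map is affine in local coordinates, because
  the sheets of the two charts can be kept fixed near a point. With \<open>f\<close> the identity this computes the
  coordinate changes.\<close>

lemma coordinate_expression:
  assumes f: "\<And>y. f (orbit G y) = orbit G (act a y)"
    and c: "c \<in> charts_at (orbit_atlas G) (orbit G x)"
    and d: "d \<in> charts_at (orbit_atlas G) (orbit G (act a x))"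
  shows "\<forall>\<^sub>F y in nhds (snd c (orbit G x)).
    (snd d \<circ> f \<circ> param c) y = act (deck d (act a x) \<star> a \<star> ainv (deck c x)) y"
proof -
  have cd: "c \<in> orbit_atlas G" "d \<in> orbit_atlas G"
    using c d by (simp_all add: charts_at_def)
  obtain V where V: "open V" "fst c = orbit G ` V" "snd c ` fst c = V"
      "\<And>y. y \<in> V \<Longrightarrow> param c y = orbit G y"
    using chartE[OF cd(1)] by metis
  obtain W where W: "open W" "fst d = orbit G ` W" "snd d ` fst d = W"
      "\<And>y. y \<in> W \<Longrightarrow> snd d (orbit G y) = y"
    using chartE[OF cd(2)] by metis
  define g where "g = deck c x"
  define h where "h = deck d (act a x)"
  have g: "g \<in> G" "snd c (orbit G x) = act g x" and h: "h \<in> G" "snd d (orbit G (act a x)) = act h (act a x)"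
    using deck[OF c] deck[OF d] by (simp_all add: g_def h_def)
  let ?k = "h \<star> a \<star> ainv g"
  define U where "U = V \<inter> act ?k -` W"
  have "open U"
    unfolding U_def by (intro open_Int V(1) open_vimage W(1) continuous_intros)
  moreover have "snd c (orbit G x) \<in> U"
  proof -
    have "snd c (orbit G x) \<in> V" "snd d (orbit G (act a x)) \<in> W"
      using c d V(3) W(3) by (auto simp: charts_at_def)
    then show ?thesis using g h by (simp add: U_def act_mult)
  qed
  moreover have "(snd d \<circ> f \<circ> param c) y = act ?k y" if "y \<in> U" for y
  proof -
    have "f (param c y) = f (orbit G (act (ainv g) y))"
      using that V(4) g by (simp add: U_def inv_mem)
    also have "\<dots> = orbit G (act ?k y)"
      using f h by (simp add: act_mult)
    finally show ?thesis using that W(4) by (simp add: U_def)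
  qed
  ultimately show ?thesis
    unfolding eventually_nhds g_def h_def by blast
qed

lemma coordinate_derivative:
  assumes "\<And>y. f (orbit G y) = orbit G (act a y)"
    and "c \<in> charts_at (orbit_atlas G) (orbit G x)"
    and "d \<in> charts_at (orbit_atlas G) (orbit G (act a x))"
  shows "frechet_derivative (snd d \<circ> f \<circ> param c) (at (snd c (orbit G x))) =
    (\<lambda>e. snd (deck d (act a x)) *v (snd a *v (snd (ainv (deck c x)) *v e)))"
proof -
  let ?k = "deck d (act a x) \<star> a \<star> ainv (deck c x)"
  have "(snd d \<circ> f \<circ> param c has_derivative (*v) (snd ?k)) (at (snd c (orbit G x)))"
    by (rule has_derivative_locally_affine[where a = "fst ?k"])
       (use coordinate_expression[OF assms] in \<open>simp_all add: act_def matrix_vector_mul_bounded_linear\<close>)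
  then have "frechet_derivative (snd d \<circ> f \<circ> param c) (at (snd c (orbit G x))) = (*v) (snd ?k)"
    by (rule frechet_derivative_at[symmetric])
  then show ?thesis
    by (simp add: snd_amult fun_eq_iff flip: matrix_vector_mul_assoc)
qed

lemma smooth_coordinate_expression:
  assumes f: "\<And>y. f (orbit G y) = orbit G (act a y)" and c: "c \<in> orbit_atlas G" and d: "d \<in> orbit_atlas G"
  shows "smooth_on (snd c ` {p \<in> fst c. f p \<in> fst d}) (snd d \<circ> f \<circ> param c)"
  unfolding smooth_on_def
proof (intro allI C_k_on_locally_affine)
  fix y assume "y \<in> snd c ` {p \<in> fst c. f p \<in> fst d}"
  then obtain p where p: "p \<in> fst c" "f p \<in> fst d" "y = snd c p" by blast
  have x: "p = orbit G y" using chart_inverse(1)[OF c p(1)] p(3) by simp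
  have cd: "c \<in> charts_at (orbit_atlas G) (orbit G y)" "d \<in> charts_at (orbit_atlas G) (orbit G (act a y))"
    using p(1,2) c d f[of y] unfolding x charts_at_def by simp_all
  let ?k = "deck d (act a y) \<star> a \<star> ainv (deck c y)"
  have "\<forall>\<^sub>F z in nhds y. (snd d \<circ> f \<circ> param c) z = fst ?k + snd ?k *v z"
  proof -
    have "snd c (orbit G y) = y" using p(3) x by metis
    then show ?thesis using coordinate_expression[OF f cd] by (simp add: act_def)
  qed
  then show "\<exists>a B. bounded_linear B \<and> (\<forall>\<^sub>F z in nhds y. (snd d \<circ> f \<circ> param c) z = a + B z)"
    using matrix_vector_mul_bounded_linear by blast
qed

lemma continuous_chart:
  assumes "c \<in> orbit_atlas G"
  shows "continuous_map (subtopology (orbit_space G) (fst c)) euclidean (snd c)"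
proof -
  obtain V where V: "open V" "fst c = orbit G ` V" "snd c ` fst c = V"
      "\<And>y. y \<in> V \<Longrightarrow> snd c (orbit G y) = y"
    using chartE[OF assms] by metis
  have "openin (subtopology (orbit_space G) (fst c)) {p \<in> fst c. snd c p \<in> U}" if "open U" for U
  proof -
    have "{p \<in> fst c. snd c p \<in> U} = orbit G ` (V \<inter> U)" using V(2,4) by auto
    moreover have "openin (orbit_space G) (orbit G ` (V \<inter> U))"
      using V(1) that by (intro openin_orbit_image open_Int)
    moreover have "orbit G ` (V \<inter> U) = orbit G ` (V \<inter> U) \<inter> fst c"
      using V(2) by blast
    ultimately show ?thesis
      unfolding openin_subtopology by auto
  qed
  moreover have "topspace (subtopology (orbit_space G) (fst c)) = fst c" using V(2) by auto
  ultimately show ?thesis by (simp add: continuous_map_def)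
qed

lemma is_chart_orbit_atlas:
  assumes "c \<in> orbit_atlas G"
  shows "is_chart (orbit_space G) c"
proof -
  obtain V where V: "open V" "fst c = orbit G ` V" "snd c ` fst c = V"
      "\<And>y. y \<in> V \<Longrightarrow> snd c (orbit G y) = y"
    using chartE[OF assms] by metis
  have "continuous_map (top_of_set V) (subtopology (orbit_space G) (fst c)) (orbit G)"
    using continuous_map_from_subtopology[OF continuous_map_orbit] V(2)
    by (auto simp: continuous_map_in_subtopology)
  moreover have "continuous_map (subtopology (orbit_space G) (fst c)) (top_of_set V) (snd c)"
    using continuous_chart[OF assms] V(3) by (auto simp: continuous_map_in_subtopology)
  ultimately have "homeomorphic_maps (subtopology (orbit_space G) (fst c)) (top_of_set V) (snd c) (orbit G)"
    using V(2,4) by (auto simp: homeomorphic_maps_def)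
  then have "homeomorphic_map (subtopology (orbit_space G) (fst c)) (top_of_set V) (snd c)"
    unfolding homeomorphic_map_maps by blast
  then show ?thesis
    unfolding is_chart_def V(3) using V(1,2) openin_orbit_image by simp
qed

lemma smooth_atlas_orbit: "smooth_atlas (orbit_space G) (orbit_atlas G)"
  unfolding smooth_atlas_def
proof (intro conjI ballI)
  show "\<Union> (fst ` orbit_atlas G) = topspace (orbit_space G)"
  proof
    show "\<Union> (fst ` orbit_atlas G) \<subseteq> topspace (orbit_space G)"
      by (auto simp: orbit_atlas_def)
    show "topspace (orbit_space G) \<subseteq> \<Union> (fst ` orbit_atlas G)"
    proof
      fix p assume "p \<in> topspace (orbit_space G)"
      then obtain x where "p = orbit G x" by auto
      then show "p \<in> \<Union> (fst ` orbit_atlas G)"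
        using some_chart[of x] unfolding charts_at_def by blast
    qed
  qed
  fix c d assume cd: "c \<in> orbit_atlas G" "d \<in> orbit_atlas G"
  have "{p \<in> fst c. id p \<in> fst d} = fst c \<inter> fst d" by auto
  with smooth_coordinate_expression[of id aone c d] cd
  show "smooth_on (snd c ` (fst c \<inter> fst d)) (snd d \<circ> param c)"
    by simp
qed (rule is_chart_orbit_atlas)

lemma compact_manifold_orbit_space: "compact_manifold (orbit_space G) (orbit_atlas G)"
  unfolding compact_manifold_def
  using compact_orbit_space Hausdorff_orbit_space second_countable_orbit_space smooth_atlas_orbit
  by blast

lemma smooth_map_affine:
  assumes f: "\<And>y. f (orbit G y) = orbit G (act a y)"
  shows "smooth_map (orbit_space G) (orbit_atlas G) f"
proof -
  have "continuous_map euclidean (orbit_space G) (orbit G \<circ> act a)"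
    using continuous_map_orbit
    by (rule continuous_map_compose[rotated]) (simp add: continuous_on_act)
  then have "continuous_map (orbit_space G) (orbit_space G) f"
    by (simp add: continuous_map_from_orbit_space f o_def)
  then show ?thesis
    unfolding smooth_map_def using smooth_coordinate_expression[OF f] by blast
qed

section \<open>Tangent vectors, differentials and the flat metric\<close>

text \<open>The differential of the projection at \<open>x\<close>, applied to \<open>e\<close>. It trivialises the tangent
  bundle over the universal cover: every tangent vector is such an image, uniquely once \<open>x\<close> is chosen,
  and changing \<open>x\<close> within its orbit applies the linear part of the deck transformation.\<close>

definition push :: "real^'n \<Rightarrow> real^'n \<Rightarrow> ((real^'n) set, real^'n) tvec" where
  "push x e = (\<lambda>c. if c \<in> charts_at (orbit_atlas G) (orbit G x) then snd (deck c x) *v e else 0)"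

lemma push_act:
  assumes "h \<in> G"
  shows "push (act h x) (snd h *v e) = push x e"
  unfolding push_def using assms deck_act[OF _ assms, of _ x]
  by (auto simp: matrix_vector_mul_assoc snd_amult[symmetric])

lemma push_add: "push x (u + v) = (\<lambda>c. push x u c + push x v c)"
  by (auto simp: push_def matrix_vector_right_distrib)

lemma push_scaleR: "push x (r *\<^sub>R u) = (\<lambda>c. r *\<^sub>R push x u c)"
  by (auto simp: push_def matrix_vector_mult_scaleR)

lemma push_0: "push x 0 = (\<lambda>c. 0)"
  by (auto simp: push_def)

lemma push_sum: "push x (\<Sum>i\<in>I. r i *\<^sub>R b i) = (\<lambda>c. \<Sum>i\<in>I. r i *\<^sub>R push x (b i) c)"
  by (induction I rule: infinite_finite_induct) (auto simp: push_0 push_add push_scaleR)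

lemma push_inject: "push x u = push x v \<longleftrightarrow> u = v"
proof
  assume eq: "push x u = push x v"
  define c where "c = (SOME c. c \<in> charts_at (orbit_atlas G) (orbit G x))"
  have c: "c \<in> charts_at (orbit_atlas G) (orbit G x)" unfolding c_def by (rule some_chart)
  then have "snd (deck c x) *v u = snd (deck c x) *v v"
    using fun_cong[OF eq, of c] by (simp add: push_def)
  then show "u = v" 
    using snd_ainv(1)[OF mem_carrier[OF deck(1)[OF c]]] by metis
qed simp

lemma coordinate_change_derivative:
  assumes "c \<in> charts_at (orbit_atlas G) (orbit G x)" "d \<in> charts_at (orbit_atlas G) (orbit G x)"
  shows "frechet_derivative (snd d \<circ> param c) (at (snd c (orbit G x))) =
    (\<lambda>e. snd (deck d x) *v (snd (ainv (deck c x)) *v e))"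
proof -
  have "snd aone *v v = v" for v :: "real^'n" by (simp add: affine_group_def)
  then show ?thesis
    using coordinate_derivative[of id aone c x d] assms by simp
qed

lemma tangent_space_orbit: "tangent_space (orbit_atlas G) (orbit G x) = range (push x)"
proof (intro subset_antisym subsetI)
  fix v assume "v \<in> range (push x)"
  then obtain e where "v = push x e" by blast
  then show "v \<in> tangent_space (orbit_atlas G) (orbit G x)"
    using snd_ainv(1)[OF mem_carrier[OF deck(1)]]
    by (auto simp: tangent_space_def push_def coordinate_change_derivative)
next
  fix v assume v: "v \<in> tangent_space (orbit_atlas G) (orbit G x)"
  define c where "c = (SOME c. c \<in> charts_at (orbit_atlas G) (orbit G x))"
  have c: "c \<in> charts_at (orbit_atlas G) (orbit G x)" unfolding c_def by (rule some_chart)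
  have "v d = push x (snd (ainv (deck c x)) *v v c) d" for d
  proof (cases "d \<in> charts_at (orbit_atlas G) (orbit G x)")
    case True
    then have "v d = frechet_derivative (snd d \<circ> param c) (at (snd c (orbit G x))) (v c)"
      using v c unfolding tangent_space_def by blast
    then show ?thesis using True coordinate_change_derivative[OF c True] by (simp add: push_def)
  next
    case False
    then have "v d = 0" using v unfolding tangent_space_def by blast
    then show ?thesis using False by (simp add: push_def)
  qed
  then show "v \<in> range (push x)" by blast
qed

text \<open>In this trivialisation the differential of a map covered by an affine map is the linear part of
  the latter. This reduces the dynamics of the differential to linear algebra.\<close>

lemma differential_push:
  assumes f: "\<And>y. f (orbit G y) = orbit G (act a y)"
  shows "differential (orbit_atlas G) f (orbit G x) (push x e) = push (act a x) (snd a *v e)"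
proof
  fix d
  define c where "c = (SOME c. c \<in> charts_at (orbit_atlas G) (orbit G x))"
  have c: "c \<in> charts_at (orbit_atlas G) (orbit G x)" unfolding c_def by (rule some_chart)
  show "differential (orbit_atlas G) f (orbit G x) (push x e) d = push (act a x) (snd a *v e) d"
    using coordinate_derivative[OF f c, of d] c snd_ainv(1)[OF mem_carrier[OF deck(1)[OF c]]]
    unfolding differential_def c_def[symmetric] Let_def f by (auto simp: push_def)
qed

lemma coord_tvec_push:
  assumes c: "c \<in> charts_at (orbit_atlas G) (orbit G y)" and y: "snd c (orbit G y) = y"
  shows "coord_tvec (orbit_atlas G) c (orbit G y) e = push y e"
proof -
  have "deck c y = aone"
    by (rule act_cancel[of _ _ y]) (use deck[OF c] y one_mem in auto)
  then have "snd (ainv (deck c y)) *v v = v" for v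
    using snd_ainv(1)[OF mem_carrier[OF one_mem], of v] by (simp add: affine_group_def)
  then show ?thesis
    using coordinate_change_derivative[OF c]
    by (auto simp: coord_tvec_def push_def)
qed

text \<open>The metric is read off in an arbitrarily chosen chart; the choice does not matter because the
  coordinate changes have orthogonal derivatives.\<close>

definition flat_metric :: "(real^'n) set \<Rightarrow> ((real^'n) set, real^'n) tvec \<Rightarrow> ((real^'n) set, real^'n) tvec \<Rightarrow> real" where
  "flat_metric p u v = (let c = SOME c. c \<in> charts_at (orbit_atlas G) p in u c \<bullet> v c)"

lemma flat_metric_push: "flat_metric (orbit G x) (push x u) (push x v) = u \<bullet> v"
proof -
  define c where "c = (SOME c. c \<in> charts_at (orbit_atlas G) (orbit G x))"
  have c: "c \<in> charts_at (orbit_atlas G) (orbit G x)" unfolding c_def by (rule some_chart)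
  have "orthogonal_transformation ((*v) (snd (deck c x)))"
    using orthogonal[OF deck(1)[OF c]] orthogonal_transformation_matrix 
    by (metis matrix_of_matrix_vector_mul matrix_vector_mul_linear)
  then show ?thesis
    using c unfolding flat_metric_def c_def[symmetric] Let_def 
    by (simp add: push_def orthogonal_transformation_def)
qed

lemma riemannian_flat_metric: "riemannian_metric (orbit_space G) (orbit_atlas G) flat_metric"
  unfolding riemannian_metric_def topspace_orbit_space
proof (rule conjI; rule ballI)
  fix p assume "p \<in> range (orbit G)"
  then obtain x where p: "p = orbit G x" by blast
  show "(\<forall>u\<in>tangent_space (orbit_atlas G) p. \<forall>v\<in>tangent_space (orbit_atlas G) p.
      \<forall>w\<in>tangent_space (orbit_atlas G) p.
         flat_metric p (\<lambda>c. u c + v c) w = flat_metric p u w + flat_metric p v w) \<and>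
      (\<forall>r. \<forall>u\<in>tangent_space (orbit_atlas G) p. \<forall>w\<in>tangent_space (orbit_atlas G) p.
         flat_metric p (\<lambda>c. r *\<^sub>R u c) w = r * flat_metric p u w) \<and>
      (\<forall>u\<in>tangent_space (orbit_atlas G) p. \<forall>w\<in>tangent_space (orbit_atlas G) p.
         flat_metric p u w = flat_metric p w u) \<and>
      (\<forall>u\<in>tangent_space (orbit_atlas G) p. u \<noteq> (\<lambda>c. 0) \<longrightarrow> 0 < flat_metric p u u)"
  proof (intro conjI)
    show "\<forall>u\<in>tangent_space (orbit_atlas G) p. u \<noteq> (\<lambda>c. 0) \<longrightarrow> 0 < flat_metric p u u"
      by (auto simp: p tangent_space_orbit flat_metric_push push_0)
  qed (auto simp: flat_metric_def Let_def inner_add_left intro: inner_commute)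
next
  fix c assume c: "c \<in> orbit_atlas G"
  obtain V where V: "open V" "inj_on (orbit G) V" "fst c = orbit G ` V" "snd c ` fst c = V"
      "\<And>y. y \<in> V \<Longrightarrow> param c y = orbit G y" "\<And>y. y \<in> V \<Longrightarrow> snd c (orbit G y) = y"
    by (rule chartE[OF c]) (rule that; assumption)
  let ?m = "\<lambda>e e' y. flat_metric (param c y) (coord_tvec (orbit_atlas G) c (param c y) e)
              (coord_tvec (orbit_atlas G) c (param c y) e')"
  have m: "?m e e' y = e \<bullet> e'" if "y \<in> V" for y e e'
    using that V c by (simp add: coord_tvec_push charts_at_def flat_metric_push)
  have "\<exists>a B. bounded_linear B \<and> (\<forall>\<^sub>F z in nhds y. ?m e e' z = a + B z)" if "y \<in> V" for y e e'
  proof -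
    have "\<forall>\<^sub>F z in nhds y. z \<in> V" using V(1) that by (rule eventually_nhds_in_open)
    then have "\<forall>\<^sub>F z in nhds y. ?m e e' z = e \<bullet> e' + 0"
      by eventually_elim (simp add: m)
    then show ?thesis using bounded_linear_zero by blast
  qed
  then show "\<forall>e\<in>Basis. \<forall>e'\<in>Basis. smooth_on (snd c ` fst c) (?m e e')"
    unfolding smooth_on_def V(4) by (intro ballI allI C_k_on_locally_affine)
qed

section \<open>Flat subbundles and Anosov affine maps\<close>

definition subbundle :: "(real^'n) set \<Rightarrow> (real^'n) set \<Rightarrow> ((real^'n) set, real^'n) tvec set" where
  "subbundle E p = {push x e |x e. orbit G x = p \<and> e \<in> E}"

lemma subbundle_orbit:
  assumes "\<And>g v. \<lbrakk>g \<in> G; v \<in> E\<rbrakk> \<Longrightarrow> snd g *v v \<in> E"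
  shows "subbundle E (orbit G x) = push x ` E"
proof (intro subset_antisym subsetI)
  fix v assume "v \<in> subbundle E (orbit G x)"
  then obtain y e where ye: "v = push y e" "orbit G x = orbit G y" "e \<in> E"
    by (auto simp: subbundle_def)
  then obtain h where h: "h \<in> G" "y = act h x" using orbit_eq_iff by metis
  have "v = push (act h x) (snd h *v (snd (ainv h) *v e))"
    using ye h by (simp add: mem_carrier)
  also have "\<dots> = push x (snd (ainv h) *v e)" using h(1) by (rule push_act)
  finally show "v \<in> push x ` E" using assms[OF inv_mem[OF h(1)] ye(3)] by blast
qed (auto simp: subbundle_def)

text \<open>A basis of \<open>E\<close>, transported by the coordinate vector fields of one chart, is a frame over the domain of
  that chart. Its coordinates in any other chart are values of the derivative of the coordinate
  change, hence continuous.\<close>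

lemma continuous_subbundle_bundle:
  assumes inv: "\<And>g v. \<lbrakk>g \<in> G; v \<in> E\<rbrakk> \<Longrightarrow> snd g *v v \<in> E" and E: "subspace E"
  shows "continuous_subbundle (orbit_space G) (orbit_atlas G) (subbundle E)"
  unfolding continuous_subbundle_def topspace_orbit_space ball_simps
proof (intro conjI allI)
  fix x
  have b: "subbundle E (orbit G x) = push x ` E" for x
    by (rule subbundle_orbit) (rule inv)
  show "subbundle E (orbit G x) \<subseteq> tangent_space (orbit_atlas G) (orbit G x)"
    by (auto simp: b tangent_space_orbit)
  show "(\<lambda>c. 0) \<in> subbundle E (orbit G x)"
    unfolding b push_0[of x, symmetric] using subspace_0[OF E] by (rule imageI)
  show "\<forall>u\<in>subbundle E (orbit G x). \<forall>v\<in>subbundle E (orbit G x). (\<lambda>c. u c + v c) \<in> subbundle E (orbit G x)"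
    using subspace_add[OF E] by (auto simp: b push_add[symmetric])
  show "\<forall>u\<in>subbundle E (orbit G x). (\<lambda>c. r *\<^sub>R u c) \<in> subbundle E (orbit G x)" for r
    using subspace_scale[OF E] by (auto simp: b push_scaleR[symmetric])
  obtain k :: nat and fr where fr: "\<And>i. i < k \<Longrightarrow> fr i \<in> E"
    "\<And>v. v \<in> E \<Longrightarrow> \<exists>!r. (\<forall>i\<ge>k. r i = 0) \<and> v = (\<Sum>i<k. r i *\<^sub>R fr i)"
    by (rule subspace_frame[OF E]) (rule that; assumption)
  obtain c0 where c0: "c0 \<in> orbit_atlas G" "orbit G x \<in> fst c0"
    using some_chart[of x] unfolding charts_at_def by blast
  define s where "s i q = coord_tvec (orbit_atlas G) c0 q (fr i)" for i :: nat and q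
  have s: "s i q = push (snd c0 q) (fr i)" and q: "q = orbit G (snd c0 q)" if "q \<in> fst c0" for i q
  proof -
    show "q = orbit G (snd c0 q)" using chart_inverse c0(1) that by metis
    then show "s i q = push (snd c0 q) (fr i)"
      using coord_tvec_push[of c0 "snd c0 q" "fr i"] c0(1) that by (simp add: s_def charts_at_def)
  qed
  have cont: "continuous_map (subtopology (orbit_space G) (fst c0 \<inter> fst c)) euclidean (\<lambda>q. s i q c)"
    if c: "c \<in> orbit_atlas G" for i c
  proof -
    let ?d = "\<lambda>y. frechet_derivative (snd c \<circ> param c0) (at y) (fr i)"
    have "smooth_on (snd c0 ` (fst c0 \<inter> fst c)) (snd c \<circ> param c0)"
      using smooth_atlas_orbit c0(1) c by (simp add: smooth_atlas_def)
    then have "C_k_on (Suc 0) (snd c0 ` (fst c0 \<inter> fst c)) (snd c \<circ> param c0)"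
      unfolding smooth_on_def by blast
    then have "continuous_map (top_of_set (snd c0 ` (fst c0 \<inter> fst c))) euclidean ?d"
      by simp
    moreover have "continuous_map (subtopology (orbit_space G) (fst c0 \<inter> fst c))
        (top_of_set (snd c0 ` (fst c0 \<inter> fst c))) (snd c0)"
      using continuous_map_from_subtopology[OF continuous_chart[OF c0(1)], of "fst c"]
      by (auto simp: subtopology_subtopology continuous_map_in_subtopology)
    ultimately have "continuous_map (subtopology (orbit_space G) (fst c0 \<inter> fst c)) euclidean (?d \<circ> snd c0)"
      by (rule continuous_map_compose[rotated])
    then show ?thesis
      by (rule continuous_map_eq) (use c in \<open>auto simp: s_def coord_tvec_def charts_at_def\<close>)
  qed
  have frame: "\<exists>!r. (\<forall>i\<ge>k. r i = 0) \<and> v = (\<lambda>c. \<Sum>i<k. r i *\<^sub>R s i q c)"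
    if qc: "q \<in> fst c0" and v: "v \<in> subbundle E q" for q v
  proof -
    have "subbundle E q = push (snd c0 q) ` E" using b q[OF qc] by metis
    then obtain e where e: "e \<in> E" "v = push (snd c0 q) e" using v by blast
    have "(v = (\<lambda>c. \<Sum>i<k. r i *\<^sub>R s i q c)) \<longleftrightarrow> e = (\<Sum>i<k. r i *\<^sub>R fr i)" for r
      unfolding e(2) s[OF qc] push_sum[symmetric] push_inject ..
    then show ?thesis using fr(2)[OF e(1)] by simp
  qed
  have sec: "s i q \<in> subbundle E q" if "q \<in> fst c0" "i < k" for i q
    using b q[OF that(1)] s[OF that(1), of i] fr(1)[OF that(2)] by (metis image_eqI)
  have "openin (orbit_space G) (fst c0)"
    using is_chart_orbit_atlas[OF c0(1)] by (simp add: is_chart_def)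
  then show "\<exists>U k. \<exists>s :: nat \<Rightarrow> (real^'n) set \<Rightarrow> ((real^'n) set, real^'n) tvec.
      openin (orbit_space G) U \<and> orbit G x \<in> U \<and>
      (\<forall>i<k. \<forall>c\<in>orbit_atlas G. continuous_map (subtopology (orbit_space G) (U \<inter> fst c)) euclidean (\<lambda>q. s i q c)) \<and>
      (\<forall>q\<in>U. (\<forall>i<k. s i q \<in> subbundle E q) \<and>
         (\<forall>v\<in>subbundle E q. \<exists>!r. (\<forall>i\<ge>k. r i = 0) \<and> v = (\<lambda>c. \<Sum>i<k. r i *\<^sub>R s i q c)))"
    using c0(2) cont frame sec by (intro exI[of _ "fst c0"] exI[of _ k] exI[of _ s]) blast
qed

lemma continuous_splitting_bundles:
  assumes inv: "\<And>g v. \<lbrakk>g \<in> G; v \<in> Es\<rbrakk> \<Longrightarrow> snd g *v v \<in> Es" "\<And>g v. \<lbrakk>g \<in> G; v \<in> Eu\<rbrakk> \<Longrightarrow> snd g *v v \<in> Eu"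
    and sub: "subspace Es" "subspace Eu"
    and sum: "\<And>v. \<exists>u\<in>Es. \<exists>w\<in>Eu. v = u + w" and int: "Es \<inter> Eu = {0}"
  shows "continuous_splitting (orbit_space G) (orbit_atlas G) (subbundle Es) (subbundle Eu)"
  unfolding continuous_splitting_def
proof (intro conjI ballI)
  show "continuous_subbundle (orbit_space G) (orbit_atlas G) (subbundle Es)"
       "continuous_subbundle (orbit_space G) (orbit_atlas G) (subbundle Eu)"
    using continuous_subbundle_bundle inv sub by blast+
  fix p v assume "p \<in> topspace (orbit_space G)" and v: "v \<in> tangent_space (orbit_atlas G) p"
  then obtain x where p: "p = orbit G x" by auto
  obtain e where e: "v = push x e" using v by (auto simp: p tangent_space_orbit)
  obtain u0 w0 where uw0: "u0 \<in> Es" "w0 \<in> Eu" "e = u0 + w0" using sum by blast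
  have uniq: "u = u0 \<and> w = w0" if "u \<in> Es" "w \<in> Eu" "e = u + w" for u w
  proof -
    have "u - u0 = w0 - w" using that uw0 by (simp add: algebra_simps)
    moreover have "u - u0 \<in> Es" "w0 - w \<in> Eu"
      using that uw0 sub by (auto intro: subspace_diff)
    ultimately have "u - u0 \<in> Es \<inter> Eu" "w0 - w \<in> Es \<inter> Eu" by simp_all
    then have "u - u0 = 0" "w0 - w = 0" unfolding int by simp_all
    then show ?thesis by simp
  qed
  show "\<exists>!(u, w). u \<in> subbundle Es p \<and> w \<in> subbundle Eu p \<and> v = (\<lambda>c. u c + w c)"
  proof (rule ex1I[of _ "(push x u0, push x w0)"])
    show "case (push x u0, push x w0) of (u, w) \<Rightarrow> u \<in> subbundle Es p \<and> w \<in> subbundle Eu p \<and> v = (\<lambda>c. u c + w c)"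
      using uw0 by (simp add: p subbundle_orbit inv e push_add)
    fix z assume z: "case z of (u, w) \<Rightarrow> u \<in> subbundle Es p \<and> w \<in> subbundle Eu p \<and> v = (\<lambda>c. u c + w c)"
    then obtain u w where uw: "z = (push x u, push x w)" "u \<in> Es" "w \<in> Eu"
      by (auto simp: p subbundle_orbit inv)
    then have "push x e = push x (u + w)" using z by (simp add: e push_add)
    then show "z = (push x u0, push x w0)" using uniq uw by (simp add: push_inject)
  qed
qed

lemma induced_map_orbit:
  assumes a: "a \<in> carrier affine_group" and norm: "(\<lambda>g. a \<star> g \<star> ainv a) ` G = G"
  shows "induced_map G (act a) (orbit G x) = orbit G (act a x)"
proof -
  have "orbit G (act a (act g x)) = orbit G (act a x)" if "g \<in> G" for g
  proof -
    have "act a (act g x) = act (a \<star> g \<star> ainv a) (act a x)"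
      using a by (simp add: act_mult)
    moreover have "a \<star> g \<star> ainv a \<in> G" using norm that by blast
    ultimately show ?thesis by simp
  qed
  then have "orbit G (act a v) = orbit G (act a x)" if "v \<in> orbit G x" for v
    using that by (auto simp: mem_orbit_iff)
  then show ?thesis
    unfolding induced_map_def using self_mem_orbit[of x] by blast
qed

lemma inv_into_induced_map:
  assumes a: "a \<in> carrier affine_group" and norm: "(\<lambda>g. a \<star> g \<star> ainv a) ` G = G"
  defines "f \<equiv> induced_map G (act a)"
  shows "bij_betw f (range (orbit G)) (range (orbit G))"
    and "inv_into (range (orbit G)) f (orbit G x) = orbit G (act (ainv a) x)"
proof -
  have f: "f (orbit G y) = orbit G (act a y)" for y
    unfolding f_def using a norm by (rule induced_map_orbit)
  have inj: "inj_on f (range (orbit G))"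
  proof (rule inj_onI, clarsimp simp: f)
    fix x y assume "orbit G (act a x) = orbit G (act a y)"
    then obtain g where g: "g \<in> G" "act a y = act g (act a x)" using orbit_eq_iff by blast
    then obtain h where h: "h \<in> G" "g = a \<star> h \<star> ainv a" using norm by blast
    have "act a y = act a (act h x)" using g(2) h(2) a by (simp add: act_mult)
    then have "y = act h x" using a by (metis act_ainv(1))
    then show "orbit G x = orbit G y" using h by simp
  qed
  have eq: "f (orbit G (act (ainv a) x)) = orbit G x" for x
    using a by (simp add: f)
  have "f ` range (orbit G) = range (orbit G)"
  proof (intro subset_antisym subsetI)
    fix P assume "P \<in> range (orbit G)"
    then obtain x where "P = orbit G x" by blast
    then show "P \<in> f ` range (orbit G)" using eq[of x] by (metis image_eqI rangeI)
  qed (auto simp: f)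
  with inj show "bij_betw f (range (orbit G)) (range (orbit G))" by (simp add: bij_betw_def)
  show "inv_into (range (orbit G)) f (orbit G x) = orbit G (act (ainv a) x)"
    by (rule inv_into_f_eq[OF inj _ eq]) simp
qed

text \<open>An affine map normalising the group is Anosov on the quotient as soon as its linear part is hyperbolic
  with a splitting that the linear parts of the group preserve: the splitting and the Euclidean
  metric both descend.\<close>

theorem anosov_induced_map:
  fixes Es Eu :: "(real^'n) set"
  assumes a: "a \<in> carrier affine_group" and norm: "(\<lambda>g. a \<star> g \<star> ainv a) ` G = G"
    and inv: "\<And>g v. \<lbrakk>g \<in> G; v \<in> Es\<rbrakk> \<Longrightarrow> snd g *v v \<in> Es" "\<And>g v. \<lbrakk>g \<in> G; v \<in> Eu\<rbrakk> \<Longrightarrow> snd g *v v \<in> Eu"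
    and sub: "subspace Es" "subspace Eu"
    and sum: "\<And>v. \<exists>u\<in>Es. \<exists>w\<in>Eu. v = u + w" and int: "Es \<inter> Eu = {0}"
    and im: "(*v) (snd a) ` Es = Es" "(*v) (snd a) ` Eu = Eu"
    and C: "C > 0" and lam: "0 < lam" "lam < 1"
    and contr: "\<And>k v. v \<in> Es \<Longrightarrow> norm (((*v) (snd a) ^^ k) v) \<le> C * lam ^ k * norm v"
    and expand: "\<And>k v. v \<in> Eu \<Longrightarrow> norm v \<le> C * lam ^ k * norm (((*v) (snd a) ^^ k) v)"
  shows "anosov_diffeomorphism (orbit_space G) (orbit_atlas G) (induced_map G (act a))"
proof -
  define f where "f = induced_map G (act a)"
  define f' where "f' = inv_into (range (orbit G)) f"
  have f: "f (orbit G y) = orbit G (act a y)" for y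
    unfolding f_def using a norm by (rule induced_map_orbit)
  have f': "f' (orbit G y) = orbit G (act (ainv a) y)" for y
    unfolding f'_def f_def using a norm by (rule inv_into_induced_map)
  have fk: "(f ^^ k) (orbit G y) = orbit G (act (apow a k) y)" for k y
    by (induction k) (simp_all add: f act_mult)
  have fk': "(f' ^^ k) (orbit G y) = orbit G (act (apow (ainv a) k) y)" for k y
    by (induction k) (simp_all add: f' act_mult)
  have bs: "subbundle Es (orbit G x) = push x ` Es" and bu: "subbundle Eu (orbit G x) = push x ` Eu" for x
    by (rule subbundle_orbit, rule inv; assumption)+
  have diff: "diffeomorphism (orbit_space G) (orbit_atlas G) f"
    unfolding diffeomorphism_def topspace_orbit_space f'_def[symmetric]
    using smooth_map_affine[OF f] smooth_map_affine[OF f'] inv_into_induced_map(1)[OF a norm]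
    by (simp add: f_def)
  have push_im: "differential (orbit_atlas G) f (orbit G x) ` push x ` E = push (act a x) ` E"
    if "(*v) (snd a) ` E = E" for x E
  proof -
    have "differential (orbit_atlas G) f (orbit G x) ` push x ` E = push (act a x) ` (*v) (snd a) ` E"
      by (simp add: image_image differential_push[OF f])
    then show ?thesis using that by simp
  qed
  have stable: "sqrt (flat_metric ((f ^^ k) p) (differential (orbit_atlas G) (f ^^ k) p v) (differential (orbit_atlas G) (f ^^ k) p v))
      \<le> C * lam ^ k * sqrt (flat_metric p v v)"
    if p: "p \<in> range (orbit G)" and v: "v \<in> subbundle Es p" for k p v
  proof -
    obtain x where x: "p = orbit G x" using p by blast
    then obtain e where e: "e \<in> Es" "v = push x e" using v bs by auto
    have "differential (orbit_atlas G) (f ^^ k) p v = push (act (apow a k) x) (((*v) (snd a) ^^ k) e)"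
      unfolding x e(2) using differential_push[OF fk] by (simp add: snd_apow)
    then show ?thesis
      using contr[OF e(1), of k] by (simp add: x e fk flat_metric_push norm_eq_sqrt_inner)
  qed
  \<comment> \<open>The inverse iterates are controlled through the forward estimate, applied to their images.\<close>
  have backward: "(((*v) (snd (ainv a))) ^^ k) e \<in> Eu \<and> (((*v) (snd a)) ^^ k) ((((*v) (snd (ainv a))) ^^ k) e) = e"
    if "e \<in> Eu" for k e
  proof (induction k)
    case (Suc k)
    obtain e' where e': "e' \<in> Eu" "(((*v) (snd (ainv a))) ^^ k) e = snd a *v e'"
      using Suc im(2) by blast
    have "(((*v) (snd a)) ^^ Suc k) ((((*v) (snd (ainv a))) ^^ Suc k) e)
        = (((*v) (snd a)) ^^ k) (snd a *v (snd (ainv a) *v ((((*v) (snd (ainv a))) ^^ k) e)))"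
      by (simp add: funpow_swap1)
    also have "\<dots> = e" using Suc a by simp
    finally show ?case using e' a by simp
  qed (simp add: that)
  have unstable: "sqrt (flat_metric ((f' ^^ k) p) (differential (orbit_atlas G) (f' ^^ k) p v) (differential (orbit_atlas G) (f' ^^ k) p v))
      \<le> C * lam ^ k * sqrt (flat_metric p v v)"
    if p: "p \<in> range (orbit G)" and v: "v \<in> subbundle Eu p" for k p v
  proof -
    obtain x where x: "p = orbit G x" using p by blast
    then obtain e where e: "e \<in> Eu" "v = push x e" using v bu by auto
    let ?e = "((*v) (snd (ainv a)) ^^ k) e"
    have "differential (orbit_atlas G) (f' ^^ k) p v = push (act (apow (ainv a) k) x) ?e"
      unfolding x e(2) using differential_push[OF fk'] by (simp add: snd_apow)
    moreover have "norm ?e \<le> C * lam ^ k * norm e"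
      using expand[of ?e k] backward[OF e(1), of k] by simp
    ultimately show ?thesis
      by (simp add: x e fk' flat_metric_push norm_eq_sqrt_inner)
  qed
  show ?thesis
    unfolding anosov_diffeomorphism_def f_def[symmetric] Let_def topspace_orbit_space f'_def[symmetric]
  proof (rule conjI, rule compact_manifold_orbit_space, rule conjI, rule diff,
      rule exI[of _ "subbundle Es"], rule exI[of _ "subbundle Eu"], rule exI[of _ flat_metric],
      rule exI[of _ C], rule exI[of _ lam], intro conjI)
    show "continuous_splitting (orbit_space G) (orbit_atlas G) (subbundle Es) (subbundle Eu)"
      using inv sub sum int by (rule continuous_splitting_bundles)
    show "\<forall>p\<in>range (orbit G). differential (orbit_atlas G) f p ` subbundle Es p = subbundle Es (f p) \<and>
        differential (orbit_atlas G) f p ` subbundle Eu p = subbundle Eu (f p)"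
      using push_im im by (auto simp: f bs bu)
    show "\<forall>k\<ge>1. \<forall>p\<in>range (orbit G).
       (\<forall>v\<in>subbundle Es p. sqrt (flat_metric ((f ^^ k) p) (differential (orbit_atlas G) (f ^^ k) p v)
             (differential (orbit_atlas G) (f ^^ k) p v)) \<le> C * lam ^ k * sqrt (flat_metric p v v)) \<and>
       (\<forall>v\<in>subbundle Eu p. sqrt (flat_metric ((f' ^^ k) p) (differential (orbit_atlas G) (f' ^^ k) p v)
             (differential (orbit_atlas G) (f' ^^ k) p v)) \<le> C * lam ^ k * sqrt (flat_metric p v v))"
      using stable unstable by blast
  qed (use riemannian_flat_metric C lam in simp_all)
qed

end

context deck_group
begin

section \<open>Lifting conjugacies\<close>

text \<open>Lifts of a homeomorphism and of its inverse are inverse to each other up to deck transformations,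
  so the lift is bijective; conjugating a deck transformation by it gives a lift of the identity, that
  is, a deck transformation again.\<close>

lemma lift_homeomorphism:
  assumes h: "homeomorphic_map (orbit_space G) (orbit_space G) h"
  obtains k where "continuous_on UNIV k" "bij k" "\<And>x. orbit G (k x) = h (orbit G x)"
    "\<And>g. g \<in> G \<Longrightarrow> \<exists>g'\<in>G. \<forall>x. k (act g x) = act g' (k x)"
    "\<And>g'. g' \<in> G \<Longrightarrow> \<exists>g\<in>G. \<forall>x. k (act g x) = act g' (k x)"
proof -
  obtain h' where "homeomorphic_maps (orbit_space G) (orbit_space G) h h'"
    using h homeomorphic_map_maps by blast
  then have cont: "continuous_map (orbit_space G) (orbit_space G) h"
      "continuous_map (orbit_space G) (orbit_space G) h'"
    and h'h: "h' (h (orbit G x)) = orbit G x" and hh': "h (h' (orbit G x)) = orbit G x" for x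
    by (auto simp: homeomorphic_maps_def)
  obtain k where k: "continuous_on UNIV k" "\<And>x. orbit G (k x) = h (orbit G x)"
    using lift_exists[OF continuous_map_compose[OF continuous_map_orbit cont(1)]] by auto
  obtain l where l: "continuous_on UNIV l" "\<And>x. orbit G (l x) = h' (orbit G x)"
    using lift_exists[OF continuous_map_compose[OF continuous_map_orbit cont(2)]] by auto
  have comp: "continuous_on UNIV (\<lambda>x. p (q x))"
    if "continuous_on UNIV p" "continuous_on UNIV q" for p q :: "real^'n \<Rightarrow> real^'n"
    using continuous_on_compose2[OF that] by simp
  have act: "continuous_on UNIV (act g)" for g :: "'n aff"
    using continuous_on_act[OF continuous_on_id] by simp
  have id: "continuous_on UNIV (\<lambda>x::real^'n. x)" by simp
  obtain a where a: "a \<in> G" "\<And>x. l (k x) = act a x"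
    by (rule lifts_differ_by_deck[OF comp[OF l(1) k(1)] id]) (simp_all add: k l h'h)
  obtain b where b: "b \<in> G" "\<And>x. k (l x) = act b x"
    by (rule lifts_differ_by_deck[OF comp[OF k(1) l(1)] id]) (simp_all add: k l hh')
  \<comment> \<open>The lift of the inverse, corrected to be the inverse of the lift.\<close>
  define m where "m y = act (ainv a) (l y)" for y
  have mk: "m (k x) = x" for x using a by (simp add: m_def)
  have km: "k (m y) = y" for y
  proof -
    have "y = k (l (act (ainv b) y))" using b by simp
    then show ?thesis using mk by metis
  qed
  have m: "continuous_on UNIV m" "\<And>y. orbit G (m y) = h' (orbit G y)"
    unfolding m_def using comp[OF act l(1)] a(1) by (simp_all add: inv_mem l(2))
  have "bij k"
    by (rule o_bij[of m]) (auto simp: fun_eq_iff mk km)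
  moreover have "\<exists>g'\<in>G. \<forall>x. k (act g x) = act g' (k x)" if g: "g \<in> G" for g
  proof -
    obtain g' where "g' \<in> G" "\<And>y. k (act g (m y)) = act g' y"
      by (rule lifts_differ_by_deck[OF comp[OF k(1) comp[OF act[of g] m(1)]] id])
         (simp_all add: k m g hh')
    then show ?thesis using mk by metis
  qed
  moreover have "\<exists>g\<in>G. \<forall>x. k (act g x) = act g' (k x)" if g': "g' \<in> G" for g'
  proof -
    obtain g where "g \<in> G" "\<And>x. m (act g' (k x)) = act g x"
      by (rule lifts_differ_by_deck[OF comp[OF m(1) comp[OF act[of g'] k(1)]] id])
         (simp_all add: k m g' h'h)
    then show ?thesis using km by metis
  qed
  ultimately show thesis
    using that k by blast
qed

text \<open>On the cover, a conjugacy holds only up to one deck transformation \<open>c\<close>, since both sides are lifts of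
  the same map.\<close>

lemma lift_conjugacy:
  assumes f: "\<And>y. f (orbit G y) = orbit G (act a y)"
    and g: "\<And>y. g (orbit G y) = orbit G (b y)" and b: "continuous_on UNIV b"
    and conj: "topologically_conjugate (orbit_space G) f (orbit_space G) g"
  obtains k c where "bij k" "c \<in> G" "\<And>x. k (act a x) = act c (b (k x))"
    "\<And>g. g \<in> G \<Longrightarrow> \<exists>g'\<in>G. \<forall>x. k (act g x) = act g' (k x)"
    "\<And>g'. g' \<in> G \<Longrightarrow> \<exists>g\<in>G. \<forall>x. k (act g x) = act g' (k x)"
proof -
  obtain h where h: "homeomorphic_map (orbit_space G) (orbit_space G) h"
      "\<And>x. h (f (orbit G x)) = g (h (orbit G x))"
    using conj by (auto simp: topologically_conjugate_def)
  obtain k where k: "continuous_on UNIV k" "bij k" "\<And>x. orbit G (k x) = h (orbit G x)"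
    "\<And>g. g \<in> G \<Longrightarrow> \<exists>g'\<in>G. \<forall>x. k (act g x) = act g' (k x)"
    "\<And>g'. g' \<in> G \<Longrightarrow> \<exists>g\<in>G. \<forall>x. k (act g x) = act g' (k x)"
    by (rule lift_homeomorphism[OF h(1)]) (rule that; assumption)
  have c1: "continuous_on UNIV (\<lambda>x. k (act a x))"
    by (rule continuous_on_compose2[OF k(1)]) (auto intro: continuous_on_act)
  have c2: "continuous_on UNIV (\<lambda>x. b (k x))"
    using continuous_on_compose2[OF b k(1)] by simp
  have eq: "orbit G (k (act a x)) = orbit G (b (k x))" for x
    using h(2)[of x] f[of x] g[of "k x"] k(3)[of x] k(3)[of "act a x"] by simp
  obtain c where "c \<in> G" "\<And>x. k (act a x) = act c (b (k x))"
    by (rule lifts_differ_by_deck[OF c1 c2 eq]) (rule that; assumption)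
  then show thesis using that[OF k(2) _ _ k(4,5)] by blast
qed

section \<open>Discreteness, torsion and uniformity\<close>

lemma discrete: "discrete G"
proof (rule discreteI)
  fix g assume g: "g \<in> G"
  have "h = g" if "h \<in> G" "dist g h < \<epsilon>" for h
  proof (rule act_separated[OF that(1) g])
    have "dist (fst g) (fst h) < \<epsilon>"
      using dist_fst_le[of g h] that(2) by simp
    then show "dist (act h 0) (act g 0) < \<epsilon>"
      by (simp add: act_def dist_commute)
  qed
  then show "g isolated_in G"
    using g \<epsilon>_pos unfolding isolated_in_dist_Ex_iff by blast
qed

text \<open>An affine map of finite order fixes the centroid of a finite orbit, whereas a nontrivial group
  element displaces it.\<close>

lemma no_torsion:
  assumes g: "g \<in> G" and n: "n > 0" and fix0: "(act g ^^ n) 0 = 0"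
  shows "g = aone"
proof -
  define y where "y i = (act g ^^ i) 0" for i
  define c where "c = (1 / real n) *\<^sub>R (\<Sum>i<n. y i)"
  have "(\<Sum>i<n. y (Suc i)) = (\<Sum>i<n. y i)"
    using sum.lessThan_Suc_shift[of y n] sum.lessThan_Suc[of y n] fix0 by (simp add: y_def)
  moreover have "(\<Sum>i<n. y (Suc i)) = real n *\<^sub>R fst g + snd g *v (\<Sum>i<n. y i)"
  proof -
    have "y (Suc i) = fst g + snd g *v y i" for i
      by (simp add: y_def act_def)
    then show ?thesis
      by (simp add: sum.distrib linear_sum[OF matrix_vector_mul_linear] sum_constant_scaleR del: sum_constant)
  qed
  ultimately have "(1 / real n) *\<^sub>R (real n *\<^sub>R fst g + snd g *v (\<Sum>i<n. y i)) = c"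
    by (simp add: c_def)
  then have "act g c = c"
    using n by (simp add: c_def act_def scaleR_right_distrib matrix_vector_mult_scaleR)
  then show ?thesis
    using displacement[OF g, of c] \<epsilon>_pos by auto
qed

lemma torsion_free_semidirect: "torsion_free (semidirect K) G"
  unfolding torsion_free_def
proof (intro ballI allI impI)
  fix h :: "'n aff" and n :: nat
  assume h: "h \<in> G" and n: "0 < n \<and> h [^]\<^bsub>semidirect K\<^esub> n = \<one>\<^bsub>semidirect K\<^esub>"
  have "act (h [^]\<^bsub>semidirect K\<^esub> m) x = (act h ^^ m) x" for m x
  proof (induction m arbitrary: x)
    case 0 then show ?case by (simp add: nat_pow_def semidirect_def)
  next
    case (Suc m)
    have "h [^]\<^bsub>semidirect K\<^esub> Suc m = (h [^]\<^bsub>semidirect K\<^esub> m) \<star> h"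
      by (simp add: nat_pow_def semidirect_def)
    then show ?case using Suc by (simp add: act_mult funpow_swap1)
  qed
  then have "(act h ^^ n) 0 = 0"
    using n by (metis act_one semidirect_def monoid.select_convs(2) monoid.update_convs(3) monoid.surjective partial_object.update_convs(1))
  then have "h = aone" using no_torsion h n by blast
  then show "h = \<one>\<^bsub>semidirect K\<^esub>" by (simp add: semidirect_def)
qed

text \<open>Every coset has a representative with translation part in a fixed ball, so the coset space is
  the image of the product of that ball with the finite holonomy group.\<close>

lemma uniform_semidirect:
  assumes K: "finite K" and GK: "G \<subseteq> UNIV \<times> K" and closed: "\<And>A B. A \<in> K \<Longrightarrow> B \<in> K \<Longrightarrow> A ** B \<in> K"
  shows "uniform_subgroup (semidirect K) G"
proof -
  let ?q = "\<lambda>g. G #>\<^bsub>semidirect K\<^esub> g"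
  let ?X = "top_of_set (UNIV \<times> K) :: 'n aff topology"
  have coset: "?q g = (\<lambda>h. h \<star> g) ` G" for g
    by (auto simp: r_coset_def semidirect_def)
  have carrier: "carrier (semidirect K) = UNIV \<times> K" by (simp add: semidirect_def)
  obtain R where R: "\<And>x. \<exists>g\<in>G. norm (act g x) \<le> R" using cocompact by blast
  have same: "?q (h \<star> g) = ?q g" if h: "h \<in> G" for g h
  proof -
    have assoc: "k \<star> (h \<star> g) = (k \<star> h) \<star> g" for k
      by (rule act_ext) (simp add: act_mult)
    have "k \<star> g = (k \<star> ainv h) \<star> (h \<star> g)" for k
      by (rule act_ext) (use h in \<open>simp add: act_mult\<close>)
    then have "k \<star> g \<in> ?q (h \<star> g)" if "k \<in> G" for k
      unfolding coset using that h by (metis image_eqI inv_mem mult_mem)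
    moreover have "k \<star> (h \<star> g) \<in> ?q g" if "k \<in> G" for k
      unfolding coset assoc using that h by (metis image_eqI mult_mem)
    ultimately show ?thesis
      unfolding coset by blast
  qed
  have top: "topspace (quotient_topology ?X ?q) = ?q ` (UNIV \<times> K)"
  proof
    show "topspace (quotient_topology ?X ?q) \<subseteq> ?q ` (UNIV \<times> K)"
      using openin_topspace[of "quotient_topology ?X ?q"] unfolding openin_quotient_topology by simp
    have "{x \<in> UNIV \<times> K. ?q x \<in> ?q ` (UNIV \<times> K)} = UNIV \<times> K" by blast
    then have "openin (quotient_topology ?X ?q) (?q ` (UNIV \<times> K))"
      unfolding openin_quotient_topology by simp
    then show "?q ` (UNIV \<times> K) \<subseteq> topspace (quotient_topology ?X ?q)"
      by (rule openin_subset)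
  qed
  have cont: "continuous_map ?X (quotient_topology ?X ?q) ?q"
    unfolding continuous_map_def top openin_quotient_topology by auto
  have "compactin ?X (cball 0 R \<times> K)"
    using compact_Times[OF compact_cball finite_imp_compact[OF K]]
    by (auto simp: compactin_subtopology)
  then have "compactin (quotient_topology ?X ?q) (?q ` (cball 0 R \<times> K))"
    using cont image_compactin by blast
  moreover have "?q ` (cball 0 R \<times> K) = ?q ` (UNIV \<times> K)"
  proof (intro subset_antisym subsetI)
    fix P assume "P \<in> ?q ` (UNIV \<times> K)"
    then obtain g where g: "snd g \<in> K" "P = ?q g" by force
    obtain h where h: "h \<in> G" "norm (act h (fst g)) \<le> R" using R by blast
    have "h \<star> g \<in> cball 0 R \<times> K"
      using h g GK closed[of "snd h" "snd g"] by (auto simp: mem_Times_iff fst_amult snd_amult)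
    then show "P \<in> ?q ` (cball 0 R \<times> K)"
      using same[OF h(1), of g] g(2) by (metis image_eqI)
  qed auto
  ultimately show ?thesis
    unfolding uniform_subgroup_def carrier compact_space_def top by simp
qed

end

lemma subgroup_semidirect:
  assumes K: "subgroup (UNIV \<times> K) affine_group" and G: "subgroup G affine_group" "G \<subseteq> UNIV \<times> K"
  shows "subgroup G (semidirect K)"
  unfolding semidirect_def
  using group.subgroup_incl[OF group_affine_group G(1) K G(2)] .

section \<open>The group and the affine map of the theorem\<close>

lemma L_mult: "L *v v = vector [- v $ 1, - v $ 2, v $ 3, v $ 4]"
  by (simp add: L_def vec_eq_iff matrix_vector_mult_def forall_4 sum_4 vector_4)

lemma L_comp [simp]:
  "(L *v v) $ 1 = - v $ 1" "(L *v v) $ 2 = - v $ 2" "(L *v v) $ 3 = v $ 3" "(L *v v) $ 4 = v $ 4"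
  by (simp_all add: L_mult vector_4)

lemma alpha_comp [simp]:
  "(snd \<alpha> *v v) $ 1 = 13 * v $ 1 + 8 * v $ 2" "(snd \<alpha> *v v) $ 2 = 8 * v $ 1 + 5 * v $ 2"
  "(snd \<alpha> *v v) $ 3 = 13 * v $ 3 + 8 * v $ 4" "(snd \<alpha> *v v) $ 4 = 8 * v $ 3 + 5 * v $ 4"
  by (simp_all add: \<alpha>_def matrix_vector_mult_def sum_4 vector_4)

lemma alpha_translation [simp]:
  "fst \<alpha> $ 1 = 1/2" "fst \<alpha> $ 2 = 1/2" "fst \<alpha> $ 3 = 0" "fst \<alpha> $ 4 = 0"
  by (simp_all add: \<alpha>_def vector_4)

lemma L_L [simp]: "L ** L = mat 1"
  by (simp add: matrix_eq vec_eq_iff forall_4 flip: matrix_vector_mul_assoc)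

lemma alpha_L: "snd \<alpha> ** L = L ** snd \<alpha>"
  by (simp add: matrix_eq vec_eq_iff forall_4 flip: matrix_vector_mul_assoc)

lemma L_neq_1 [simp]: "L \<noteq> mat 1" "mat 1 \<noteq> L"
proof -
  have "L *v axis 1 1 \<noteq> mat 1 *v axis 1 1"
    by (simp add: vec_eq_iff forall_4)
  then show "L \<noteq> mat 1" by metis
  then show "mat 1 \<noteq> L" by simp
qed

lemma orthogonal_F: "B \<in> F \<Longrightarrow> orthogonal_matrix B"
proof -
  have "transpose L = L"
    by (simp add: L_def transpose_def vec_eq_iff forall_4 vector_4)
  then show "B \<in> F \<Longrightarrow> orthogonal_matrix B"
    by (auto simp: F_def orthogonal_matrix_def transpose_mat)
qed

definition shift :: "real^4" where "shift = vector [0, 0, 1/2, 1/2]"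

definition integer_lattice :: "(real^4) set" where "integer_lattice = {v. \<forall>i. v $ i \<in> \<int>}"

lemma shift_comp [simp]: "shift $ 1 = 0" "shift $ 2 = 0" "shift $ 3 = 1/2" "shift $ 4 = 1/2"
  by (simp_all add: shift_def vector_4)

lemma integer_lattice_iff: "v \<in> integer_lattice \<longleftrightarrow> v $ 1 \<in> \<int> \<and> v $ 2 \<in> \<int> \<and> v $ 3 \<in> \<int> \<and> v $ 4 \<in> \<int>"
  by (simp add: integer_lattice_def forall_4)

text \<open>The explicit form of the generated group: integer translations together with screw motions
  along half of \<open>e\<^sub>3 + e\<^sub>4\<close>.\<close>

definition screw_group :: "4 aff set" where
  "screw_group = {(v, mat 1) |v. v \<in> integer_lattice} \<union> {(v + shift, L) |v. v \<in> integer_lattice}"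

lemma mem_screw_group: "(v, B) \<in> screw_group \<longleftrightarrow> B = mat 1 \<and> v \<in> integer_lattice \<or> B = L \<and> v - shift \<in> integer_lattice"
  unfolding screw_group_def by (auto simp: algebra_simps)

lemma amult_pair: "(v, B) \<star> (w, D) = (v + B *v w, B ** D)"
  by (simp add: affine_group_def)

lemma aone_pair: "aone = (0, mat 1)"
  by (simp add: affine_group_def)

lemma lattice_closed: "v \<in> integer_lattice \<Longrightarrow> w \<in> integer_lattice \<Longrightarrow> v + w \<in> integer_lattice"
  "v \<in> integer_lattice \<Longrightarrow> - v \<in> integer_lattice" "v \<in> integer_lattice \<Longrightarrow> L *v v \<in> integer_lattice"
  "v \<in> integer_lattice \<Longrightarrow> w \<in> integer_lattice \<Longrightarrow> v - w \<in> integer_lattice"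
  by (simp_all add: integer_lattice_iff)

lemma inv_1: "ainv (v :: real^4, mat 1) = (- v, mat 1)"
proof -
  have "invertible (mat 1 :: real^4^4)" unfolding invertible_def by (auto intro: exI[of _ "mat 1"])
  then show ?thesis
    by (intro group.inv_equality[OF group_affine_group]) (simp_all add: affine_group_def)
qed

lemma inv_L: "ainv (v, L) = (- (L *v v), L)"
proof -
  have "invertible L" unfolding invertible_def by (auto intro: exI[of _ L])
  then show ?thesis
    by (intro group.inv_equality[OF group_affine_group]) (simp_all add: affine_group_def)
qed

lemma subgroup_UNIV_F: "subgroup (UNIV \<times> F) affine_group"
proof (rule group.subgroupI[OF group_affine_group])
  have "invertible L" "invertible (mat 1 :: real^4^4)"
    unfolding invertible_def by (auto intro: exI[of _ L] exI[of _ "mat 1"])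
  then show "UNIV \<times> F \<subseteq> carrier affine_group" by (auto simp: affine_group_def F_def)
qed (auto simp: F_def inv_1 inv_L amult_pair)

lemma shift_L_shift: "shift + L *v shift \<in> integer_lattice"
  by (simp add: integer_lattice_iff)

lemma subgroup_screw_group: "subgroup screw_group affine_group"
proof (rule group.subgroupI[OF group_affine_group])
  show "screw_group \<subseteq> carrier affine_group"
    using subgroup.subset[OF subgroup_UNIV_F] by (auto simp: screw_group_def F_def)
  show "screw_group \<noteq> {}" by (auto simp: screw_group_def integer_lattice_def intro!: exI[of _ 0])
  fix g assume g: "g \<in> screw_group"
  obtain v B where vB: "g = (v, B)" by (cases g)
  have "- (L *v v) - shift = - (L *v (v - shift)) - (shift + L *v shift)"
    by (simp add: vec_eq_iff forall_4)
  then have "- (L *v v) - shift \<in> integer_lattice" if "v - shift \<in> integer_lattice"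
    using lattice_closed(4)[OF lattice_closed(2)[OF lattice_closed(3)[OF that]] shift_L_shift] by metis
  then show "ainv g \<in> screw_group"
    using g lattice_closed(2)[of v] unfolding vB by (auto simp: mem_screw_group inv_1 inv_L)
  fix h assume h: "h \<in> screw_group"
  obtain w D where wD: "h = (w, D)" by (cases h)
  have "v + w - shift \<in> integer_lattice" if "v \<in> integer_lattice" "w - shift \<in> integer_lattice"
    using lattice_closed(1)[OF that] by (simp add: algebra_simps)
  moreover have "v + L *v w - shift \<in> integer_lattice" if "v - shift \<in> integer_lattice" "w \<in> integer_lattice"
    using lattice_closed(1)[OF that(1) lattice_closed(3)[OF that(2)]] by (simp add: algebra_simps)
  moreover have "v + L *v w \<in> integer_lattice" if "v - shift \<in> integer_lattice" "w - shift \<in> integer_lattice"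
  proof -
    have "v + L *v w = (v - shift) + L *v (w - shift) + (shift + L *v shift)"
      by (simp add: vec_eq_iff forall_4)
    then show ?thesis
      using lattice_closed(1)[OF lattice_closed(1)[OF that(1) lattice_closed(3)[OF that(2)]] shift_L_shift]
      by metis
  qed
  ultimately show "g \<star> h \<in> screw_group"
    using g h lattice_closed(1)[of v w] unfolding vB wD mem_screw_group amult_pair by auto
qed

lemma \<Gamma>_eq: "\<Gamma> = screw_group"
proof
  let ?S = "{(axis 1 1, mat 1), (axis 2 1, mat 1), (axis 3 1, mat 1), (axis 4 1, mat 1), (shift, L)} :: 4 aff set"
  have \<Gamma>: "\<Gamma> = generate affine_group ?S" by (simp add: \<Gamma>_def shift_def)
  have S: "?S \<subseteq> screw_group"
    by (auto simp: mem_screw_group integer_lattice_iff axis_def)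
  then show "\<Gamma> \<subseteq> screw_group"
    unfolding \<Gamma> by (intro group.generate_subgroup_incl[OF group_affine_group _ subgroup_screw_group])
  have "?S \<subseteq> carrier affine_group"
    using S subgroup.subset[OF subgroup_screw_group] by blast
  then have sub: "subgroup \<Gamma> affine_group"
    unfolding \<Gamma> by (rule group.generate_is_subgroup[OF group_affine_group])
  have incl: "?S \<subseteq> \<Gamma>" unfolding \<Gamma> by (auto intro: generate.incl)
  have add: "(v + w, mat 1) \<in> \<Gamma>" if "(v, mat 1) \<in> \<Gamma>" "(w, mat 1) \<in> \<Gamma>" for v w
    using subgroup.m_closed[OF sub that] by (simp add: amult_pair)
  have zero: "(0, mat 1) \<in> \<Gamma>" using subgroup.one_closed[OF sub] by (simp add: aone_pair)
  have neg: "(- v, mat 1) \<in> \<Gamma>" if "(v, mat 1) \<in> \<Gamma>" for v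
    using subgroup.m_inv_closed[OF sub that] by (simp add: inv_1)
  have multiple: "(x *\<^sub>R v, mat 1) \<in> \<Gamma>" if v: "(v, mat 1) \<in> \<Gamma>" and x: "x \<in> \<int>" for v x
  proof -
    have nat: "(real n *\<^sub>R v, mat 1) \<in> \<Gamma>" for n
      by (induction n) (simp_all add: zero add[OF v] scaleR_left_distrib)
    obtain m where "x = of_int m" using x by (auto elim: Ints_cases)
    then show ?thesis
      using nat[of "nat m"] neg[OF nat[of "nat (- m)"]] by (cases "m \<ge> 0") auto
  qed
  have translation: "(v, mat 1) \<in> \<Gamma>" if v: "v \<in> integer_lattice" for v
  proof -
    have "v = v $ 1 *\<^sub>R axis 1 1 + v $ 2 *\<^sub>R axis 2 1 + v $ 3 *\<^sub>R axis 3 1 + v $ 4 *\<^sub>R axis 4 1"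
      by (simp add: vec_eq_iff forall_4 axis_def)
    moreover have "(v $ 1 *\<^sub>R axis 1 1 + v $ 2 *\<^sub>R axis 2 1 + v $ 3 *\<^sub>R axis 3 1 + v $ 4 *\<^sub>R axis 4 1, mat 1) \<in> \<Gamma>"
      using v incl by (intro add multiple) (auto simp: integer_lattice_iff)
    ultimately show ?thesis by simp
  qed
  have "(v + shift, L) \<in> \<Gamma>" if "v \<in> integer_lattice" for v
    using subgroup.m_closed[OF sub translation[OF that], of "(shift, L)"] incl by (simp add: amult_pair)
  with translation show "screw_group \<subseteq> \<Gamma>" by (auto simp: screw_group_def)
qed

lemma mem_\<Gamma>: "(v, B) \<in> \<Gamma> \<longleftrightarrow> B = mat 1 \<and> v \<in> integer_lattice \<or> B = L \<and> v - shift \<in> integer_lattice"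
  by (simp add: \<Gamma>_eq mem_screw_group)

lemma subgroup_\<Gamma>: "subgroup \<Gamma> affine_group"
  by (simp add: \<Gamma>_eq subgroup_screw_group)

lemma \<Gamma>_F: "\<Gamma> \<subseteq> UNIV \<times> F"
  by (auto simp: mem_\<Gamma> F_def)

lemma half_Ints: "x - 1/2 \<in> \<int> \<Longrightarrow> 1/2 \<le> \<bar>x::real\<bar>"
proof -
  assume "x - 1/2 \<in> \<int>"
  then obtain n :: int where "x = of_int n + 1/2" by (auto elim!: Ints_cases simp: algebra_simps)
  then show ?thesis by (cases "n \<ge> 0") (auto simp: abs_if)
qed

text \<open>A translation moves some coordinate by a nonzero integer; a screw motion moves the third
  coordinate by a half-integer, whatever the point.\<close>

lemma \<Gamma>_displacement:
  assumes g: "g \<in> \<Gamma>" "g \<noteq> aone"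
  shows "1/2 \<le> dist (act g x) x"
proof -
  obtain v B where vB: "g = (v, B)" by (cases g)
  have comp: "\<bar>(act g x - x) $ i\<bar> \<le> dist (act g x) x" for i
    using component_le_norm_cart by (metis dist_norm)
  consider "B = mat 1" "v \<in> integer_lattice" | "B = L" "v - shift \<in> integer_lattice"
    using g(1) vB mem_\<Gamma> by blast
  then show ?thesis
  proof cases
    case 1
    then have "v \<noteq> 0" using g(2) vB by (auto simp: aone_pair)
    then obtain i where "v $ i \<noteq> 0" by (auto simp: vec_eq_iff)
    then have "1 \<le> \<bar>v $ i\<bar>" using 1 by (intro Ints_nonzero_abs_ge1) (auto simp: integer_lattice_def)
    then show ?thesis using comp[of i] 1 vB by (simp add: act_def)
  next
    case 2
    then have "1/2 \<le> \<bar>v $ 3\<bar>" by (intro half_Ints) (auto simp: integer_lattice_iff)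
    then show ?thesis using comp[of 3] 2 vB by (simp add: act_def)
  qed
qed

lemma \<Gamma>_cocompact: "\<exists>g\<in>\<Gamma>. norm (act g x) \<le> 4"
proof -
  define v :: "real^4" where "v = (\<chi> i. - of_int \<lfloor>x $ i\<rfloor>)"
  have "(v, mat 1) \<in> \<Gamma>" by (simp add: mem_\<Gamma> v_def integer_lattice_def)
  moreover have "norm (act (v, mat 1) x) \<le> (\<Sum>i\<in>UNIV. \<bar>frac (x $ i)\<bar>)"
    using norm_le_l1_cart[of "act (v, mat 1) x"] by (simp add: act_def v_def frac_def algebra_simps)
  moreover have "(\<Sum>i\<in>UNIV. \<bar>frac (x $ i)\<bar>) \<le> (\<Sum>i\<in>(UNIV :: 4 set). 1)"
    by (rule sum_mono) (simp add: frac_lt_1 less_imp_le)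
  ultimately show ?thesis by (intro bexI[of _ "(v, mat 1)"]) auto
qed

interpretation \<Gamma>: deck_group \<Gamma> "1/2"
proof (rule deck_group.intro)
  show "subgroup \<Gamma> affine_group" by (rule subgroup_\<Gamma>)
  show "orthogonal_matrix (snd g)" if "g \<in> \<Gamma>" for g
    using that \<Gamma>_F orthogonal_F by (auto simp: mem_Times_iff)
  show "\<exists>R. \<forall>x. \<exists>g\<in>\<Gamma>. norm (act g x) \<le> R" using \<Gamma>_cocompact by blast
qed (use \<Gamma>_displacement in auto)

text \<open>Conjugating a screw motion by \<open>\<alpha>\<close> applies the integral matrix to its translation part and adds
  \<open>t - L t = (1, 1, 0, 0)\<close>, where \<open>t\<close> is the translation part of \<open>\<alpha>\<close>. That this vector is integral is
  why \<open>\<alpha>\<close> descends to the quotient; that it is odd is why no automorphism can imitate it.\<close>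

lemma alpha_normalizes: "(\<lambda>g. \<alpha> \<star> g \<star> ainv \<alpha>) ` \<Gamma> = \<Gamma>"
proof -
  define u :: "real^4" where "u = vector [1, 1, 0, 0]"
  have u: "u $ 1 = 1" "u $ 2 = 1" "u $ 3 = 0" "u $ 4 = 0" by (simp_all add: u_def vector_4)
  have conj: "\<alpha> \<star> g \<star> ainv \<alpha> = h" if "\<alpha> \<star> g = h \<star> \<alpha>" for g h
    by (rule act_ext) (metis that act_mult act_ainv(2) alpha_in_affine_group)
  have conj_1: "\<alpha> \<star> (v, mat 1) \<star> ainv \<alpha> = (snd \<alpha> *v v, mat 1)" for v
    by (rule conj) (simp add: prod_eq_iff fst_amult snd_amult act_def)
  have conj_L: "\<alpha> \<star> (v, L) \<star> ainv \<alpha> = (snd \<alpha> *v v + u, L)" for v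
    by (rule conj) (simp add: prod_eq_iff fst_amult snd_amult act_def alpha_L vec_eq_iff forall_4 u)
  have A: "snd \<alpha> *v v \<in> integer_lattice" if "v \<in> integer_lattice" for v
    using that by (simp add: integer_lattice_iff)
  have "\<exists>v\<in>integer_lattice. w = snd \<alpha> *v v" if "w \<in> integer_lattice" for w
  proof
    define v :: "real^4" where "v = vector [5 * w $ 1 - 8 * w $ 2, 13 * w $ 2 - 8 * w $ 1,
      5 * w $ 3 - 8 * w $ 4, 13 * w $ 4 - 8 * w $ 3]"
    show "v \<in> integer_lattice" using that by (simp add: v_def vector_4 integer_lattice_iff)
    show "w = snd \<alpha> *v v" by (simp add: v_def vector_4 vec_eq_iff forall_4)
  qed
  then have A_onto: "\<exists>v\<in>integer_lattice. w = snd \<alpha> *v v" if "w \<in> integer_lattice" for w using that by blast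
  have s: "snd \<alpha> *v shift + u - shift \<in> integer_lattice"
    by (simp add: integer_lattice_iff u)
  show ?thesis
  proof (intro subset_antisym subsetI)
    fix h assume "h \<in> (\<lambda>g. \<alpha> \<star> g \<star> ainv \<alpha>) ` \<Gamma>"
    then obtain v B where vB: "(v, B) \<in> \<Gamma>" "h = \<alpha> \<star> (v, B) \<star> ainv \<alpha>" by auto
    consider "B = mat 1" "v \<in> integer_lattice" | "B = L" "v - shift \<in> integer_lattice"
      using vB(1) mem_\<Gamma> by blast
    then show "h \<in> \<Gamma>"
    proof cases
      case 1
      then show ?thesis using vB(2) A by (simp add: conj_1 mem_\<Gamma>)
    next
      case 2
      have "snd \<alpha> *v v + u - shift = snd \<alpha> *v (v - shift) + (snd \<alpha> *v shift + u - shift)"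
        by (simp add: matrix_vector_mult_diff_distrib)
      then have "snd \<alpha> *v v + u - shift \<in> integer_lattice"
        using lattice_closed(1)[OF A[OF 2(2)] s] by metis
      then show ?thesis using vB(2) 2(1) by (simp add: conj_L mem_\<Gamma>)
    qed
  next
    fix h assume h: "h \<in> \<Gamma>"
    obtain w B where wB: "h = (w, B)" by (cases h)
    consider "B = mat 1" "w \<in> integer_lattice" | "B = L" "w - shift \<in> integer_lattice"
      using h wB mem_\<Gamma> by blast
    then show "h \<in> (\<lambda>g. \<alpha> \<star> g \<star> ainv \<alpha>) ` \<Gamma>"
    proof cases
      case 1
      then obtain v where "v \<in> integer_lattice" "w = snd \<alpha> *v v" using A_onto by blast
      then show ?thesis
        using wB 1 by (intro image_eqI[of _ _ "(v, mat 1)"]) (simp_all add: conj_1 mem_\<Gamma>)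
    next
      case 2
      then have "(w - shift) - (snd \<alpha> *v shift + u - shift) \<in> integer_lattice"
        using s by (intro lattice_closed(4)[OF _ s]) simp
      then obtain v where v: "v \<in> integer_lattice" "(w - shift) - (snd \<alpha> *v shift + u - shift) = snd \<alpha> *v v"
        using A_onto by blast
      then have "w = snd \<alpha> *v (v + shift) + u"
        by (simp add: matrix_vector_right_distrib algebra_simps)
      then show ?thesis
        using wB 2 v by (intro image_eqI[of _ _ "(v + shift, L)"]) (simp_all add: conj_L mem_\<Gamma>)
    qed
  qed
qed

lemma induced_alpha: "induced_map \<Gamma> (act \<alpha>) (orbit \<Gamma> v) = orbit \<Gamma> (act \<alpha> v)"
  using \<Gamma>.induced_map_orbit[OF alpha_in_affine_group alpha_normalizes] .

text \<open>The matrix \<open>((13, 8), (8, 5))\<close> is the sixth power of the Fibonacci matrix, so its eigenvectors are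
  \<open>(1, - golden)\<close> and \<open>(golden, 1)\<close>, and its eigenvalues are the powers of the golden ratio
  \<open>golden\<close> with exponents \<open>- 6\<close> and \<open>6\<close>.\<close>

definition golden :: real where "golden = (1 + sqrt 5) / 2"

lemma golden: "golden * golden = golden + 1" "3/2 < golden" "golden < 13/8"
proof -
  show "golden * golden = golden + 1"
    by (simp add: golden_def field_simps)
  have "2 < sqrt 5" by (rule real_less_rsqrt) simp
  then show "3/2 < golden" by (simp add: golden_def)
  have "sqrt 5 < 9/4" by (rule real_less_lsqrt) (simp_all add: power2_eq_square)
  then show "golden < 13/8" by (simp add: golden_def)
qed

lemma scaling_power:
  assumes "A *v v = c *\<^sub>R v"
  shows "(((*v) A) ^^ k) v = c ^ k *\<^sub>R (v :: real^'n)"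
  by (induction k) (simp_all add: assms matrix_vector_mult_scaleR)

lemma anosov_alpha: "anosov_diffeomorphism (orbit_space \<Gamma>) (orbit_atlas \<Gamma>) (induced_map \<Gamma> (act \<alpha>))"
proof -
  define \<mu> where "\<mu> = 13 - 8 * golden"
  define \<nu> where "\<nu> = 8 * golden + 5"
  have \<mu>: "0 < \<mu>" "\<mu> < 1" using golden by (simp_all add: \<mu>_def)
  have \<nu>: "\<nu> > 0" using golden by (simp add: \<nu>_def)
  have \<mu>\<nu>: "\<mu> * \<nu> = 1"
  proof -
    have "\<mu> * \<nu> = 64 * golden + 65 - 64 * (golden * golden)" by (simp add: \<mu>_def \<nu>_def algebra_simps)
    then show ?thesis by (simp add: golden(1))
  qed
  define Es :: "(real^4) set" where "Es = {v. v $ 2 = - golden * v $ 1 \<and> v $ 4 = - golden * v $ 3}"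
  define Eu :: "(real^4) set" where "Eu = {v. v $ 1 = golden * v $ 2 \<and> v $ 3 = golden * v $ 4}"
  have gg: "golden * (golden * x) = golden * x + x" for x
    using golden(1) by (metis distrib_right mult.assoc mult_1)
  have scale_s: "snd \<alpha> *v v = \<mu> *\<^sub>R v" if "v \<in> Es" for v
    using that by (simp add: Es_def vec_eq_iff forall_4 \<mu>_def gg algebra_simps)
  have scale_u: "snd \<alpha> *v v = \<nu> *\<^sub>R v" if "v \<in> Eu" for v
    using that by (simp add: Eu_def vec_eq_iff forall_4 \<nu>_def gg algebra_simps)
  have sub: "subspace Es" "subspace Eu"
    by (auto simp: subspace_def Es_def Eu_def algebra_simps)
  have im: "(*v) (snd \<alpha>) ` E = E" if E: "subspace E" and c: "c \<noteq> 0" "\<And>v. v \<in> E \<Longrightarrow> snd \<alpha> *v v = c *\<^sub>R v" for E c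
  proof (intro subset_antisym subsetI)
    fix v assume v: "v \<in> E"
    then have "(1/c) *\<^sub>R v \<in> E" using E by (rule subspace_scale[rotated])
    then show "v \<in> (*v) (snd \<alpha>) ` E"
      using c by (intro image_eqI[of _ _ "(1/c) *\<^sub>R v"]) auto
  qed (auto simp: c(2) subspace_scale[OF E])
  show ?thesis
  proof (rule \<Gamma>.anosov_induced_map[OF alpha_in_affine_group alpha_normalizes, where Es = Es and Eu = Eu and C = 1 and lam = \<mu>])
    show "snd g *v v \<in> Es" if "g \<in> \<Gamma>" "v \<in> Es" for g v
      using that \<Gamma>_F by (auto simp: F_def Es_def)
    show "snd g *v v \<in> Eu" if "g \<in> \<Gamma>" "v \<in> Eu" for g v
      using that \<Gamma>_F by (auto simp: F_def Eu_def)
    show "\<exists>u\<in>Es. \<exists>w\<in>Eu. v = u + w" for v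
    proof -
      define p where "p x y = (x - golden * y) / (1 + golden * golden)" for x y :: real
      define u :: "real^4" where "u = vector [p (v $ 1) (v $ 2), - golden * p (v $ 1) (v $ 2),
        p (v $ 3) (v $ 4), - golden * p (v $ 3) (v $ 4)]"
      have "1 + golden * golden \<noteq> 0" using golden(2) by (simp add: golden(1))
      then have p: "p x y * (1 + golden * golden) = x - golden * y" for x y
        by (simp add: p_def)
      have "u \<in> Es" by (simp add: u_def Es_def vector_4)
      moreover have "v - u \<in> Eu"
        using p[of "v $ 1" "v $ 2"] p[of "v $ 3" "v $ 4"] by (simp add: u_def Eu_def vector_4 algebra_simps)
      ultimately show ?thesis by (intro bexI[of _ u] bexI[of _ "v - u"]) auto
    qed
    show "Es \<inter> Eu = {0}"
    proof -
      have "v = 0" if "v \<in> Es" "v \<in> Eu" for v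
      proof -
        have eq: "\<mu> *\<^sub>R v = \<nu> *\<^sub>R v" using scale_s scale_u that by metis
        have "\<mu> \<noteq> \<nu>" using golden by (simp add: \<mu>_def \<nu>_def)
        then show ?thesis using eq by simp
      qed
      then show ?thesis using sub subspace_0 by auto
    qed
    show "norm (((*v) (snd \<alpha>) ^^ k) v) \<le> 1 * \<mu> ^ k * norm v" if "v \<in> Es" for k v
      using \<mu> by (simp add: scaling_power[OF scale_s[OF that]])
    show "norm v \<le> 1 * \<mu> ^ k * norm (((*v) (snd \<alpha>) ^^ k) v)" if "v \<in> Eu" for k v
    proof -
      have "\<mu> ^ k * \<nu> ^ k = 1" using \<mu>\<nu> by (simp flip: power_mult_distrib)
      then show ?thesis
        using \<nu> by (simp add: scaling_power[OF scale_u[OF that]] flip: mult.assoc)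
    qed
  qed (use sub \<mu> \<nu> im[OF sub(1) _ scale_s] im[OF sub(2) _ scale_u] in simp_all)
qed

section \<open>No conjugacy to an infra-nilmanifold automorphism\<close>

text \<open>An automorphism fixing the holonomy group acts on translations by an additive map \<open>b\<close> commuting with
  \<open>L\<close>. The translation part of the screw motion \<open>f\<close> is fixed by \<open>L\<close>, hence so is its image, and
  therefore \<open>f\<close> is carried to \<open>f\<close> times a translation \<open>z\<close> along the last two axes, which is central.\<close>

lemma infranil_automorphism_lift:
  assumes "infranil_automorphism \<Gamma> F g"
  obtains b z where "continuous_on UNIV b" "\<And>v. g (orbit \<Gamma> v) = orbit \<Gamma> (b v)"
    "(z, mat 1) \<in> \<Gamma>" "z $ 1 = 0" "z $ 2 = 0"
    "\<And>v. b (act (shift, L) v) = act (z, mat 1) (act (shift, L) (b v))"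
proof -
  obtain \<phi> where \<phi>: "lie_group_automorphism F \<phi>" "\<phi> ` ({0} \<times> F) = {0} \<times> F" "\<phi> ` \<Gamma> = \<Gamma>"
      "\<And>v. g (orbit \<Gamma> v) = orbit \<Gamma> (fst (\<phi> (v, mat 1)))"
    using assms unfolding infranil_automorphism_def by blast
  have F: "mat 1 \<in> F" "L \<in> F" by (simp_all add: F_def)
  have iso: "\<phi> \<in> iso (semidirect F) (semidirect F)"
    and smooth: "smooth_on UNIV (\<lambda>v. \<phi> (v, mat 1))"
    using \<phi>(1) F unfolding lie_group_automorphism_def by blast+
  have hom: "\<phi> (x \<star> y) = \<phi> x \<star> \<phi> y" if "x \<in> UNIV \<times> F" "y \<in> UNIV \<times> F" for x y
    using iso that by (auto simp: iso_def hom_def semidirect_def)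
  have inj: "inj_on \<phi> (UNIV \<times> F)" and maps: "\<And>x. x \<in> UNIV \<times> F \<Longrightarrow> \<phi> x \<in> UNIV \<times> F"
    using iso by (auto simp: iso_def semidirect_def bij_betw_def)
  define b where "b v = fst (\<phi> (v, mat 1))" for v
  have \<phi>_1: "\<phi> (v, mat 1) = (b v, mat 1)" for v
  proof -
    \<comment> \<open>A translation is a square, and squares have trivial holonomy because the holonomy group has order 2.\<close>
    let ?w = "(1/2) *\<^sub>R v"
    have "?w + ?w = v" by (simp flip: scaleR_left_distrib)
    then have "\<phi> (v, mat 1) = \<phi> (?w, mat 1) \<star> \<phi> (?w, mat 1)"
      using hom[of "(?w, mat 1)" "(?w, mat 1)"] F by (simp add: amult_pair)
    moreover have "snd (\<phi> (?w, mat 1)) \<in> {mat 1, L}"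
      using maps[of "(?w, mat 1)"] F by (auto simp: F_def mem_Times_iff)
    ultimately have "snd (\<phi> (v, mat 1)) = mat 1" by (auto simp: snd_amult)
    then show ?thesis by (simp add: b_def prod_eq_iff)
  qed
  have \<phi>_0L: "\<phi> (0, L) = (0, L)"
  proof -
    have im: "\<phi> (0, mat 1) \<in> {0} \<times> F" "\<phi> (0, L) \<in> {0} \<times> F" using \<phi>(2) F by blast+
    have "\<phi> (0, L) \<noteq> \<phi> (0, mat 1)"
      using inj_onD[OF inj, of "(0, L)" "(0, mat 1)"] F by auto
    then show ?thesis using im by (auto simp: \<phi>_1 F_def)
  qed
  have \<phi>_L: "\<phi> (v, L) = (b v, L)" for v
    using hom[of "(v, mat 1)" "(0, L)"] F by (simp add: amult_pair \<phi>_1 \<phi>_0L)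
  have b_add: "b (v + w) = b v + b w" for v w
    using hom[of "(v, mat 1)" "(w, mat 1)"] F by (simp add: amult_pair \<phi>_1)
  have b_0: "b 0 = 0" using b_add[of 0 0] by simp
  have b_L: "b (L *v v) = L *v b v" for v
    using hom[of "(0, L)" "(v, mat 1)"] F by (simp add: amult_pair \<phi>_1 \<phi>_L \<phi>_0L b_0)
  have L_shift: "L *v shift = shift" by (simp add: vec_eq_iff forall_4)
  define z where "z = b shift - shift"
  have "(shift, L) \<in> \<Gamma>" by (simp add: mem_\<Gamma> integer_lattice_iff)
  then have "(b shift, L) \<in> \<Gamma>" using \<phi>(3) \<phi>_L by (metis imageI)
  then have "(z, mat 1) \<in> \<Gamma>" by (simp add: mem_\<Gamma> z_def)
  moreover have "z $ 1 = 0" "z $ 2 = 0"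
  proof -
    have "L *v b shift = b shift" using b_L[of shift] by (simp add: L_shift)
    then have "(L *v b shift) $ i = b shift $ i" for i by simp
    from this[of 1] this[of 2] show "z $ 1 = 0" "z $ 2 = 0" by (simp_all add: z_def)
  qed
  moreover have "b (act (shift, L) v) = act (z, mat 1) (act (shift, L) (b v))" for v
    by (simp add: act_def b_add b_L z_def)
  moreover have "continuous_on UNIV b"
  proof -
    have "C_k_on 0 UNIV (\<lambda>v. \<phi> (v, mat 1))" using smooth unfolding smooth_on_def by blast
    then show ?thesis unfolding b_def by (auto intro: continuous_on_fst)
  qed
  moreover have "g (orbit \<Gamma> v) = orbit \<Gamma> (b v)" for v by (simp add: \<phi>(4) b_def)
  ultimately show thesis using that by blast
qed

lemma central_translation:
  assumes "z $ 1 = 0" "z $ 2 = 0" "g \<in> \<Gamma>"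
  shows "act g (act (z, mat 1) x) = act (z, mat 1) (act g x)"
  using assms \<Gamma>_F by (auto simp: F_def act_def vec_eq_iff forall_4)

text \<open>The property transported by a conjugacy is the existence of an element that is not a translation and is
  carried by the automorphism, up to a central factor, to one of its conjugates. A lifted
  infra-nilmanifold automorphism has it, with \<open>f\<close>. For conjugation by \<open>\<alpha>\<close> it fails modulo 2 in the first
  coordinate \<open>v\<^sub>1\<close> of the translation part: the matrix of \<open>\<alpha>\<close> is the identity modulo 2 and
  conjugation in \<open>\<Gamma>\<close> changes \<open>v\<^sub>1\<close> by even numbers and signs only, but
  \<open>\<alpha>\<close> adds the odd number 1.\<close>

lemma not_conjugate:
  assumes "infranil_automorphism \<Gamma> F g"
    and "topologically_conjugate (orbit_space \<Gamma>) (induced_map \<Gamma> (act \<alpha>)) (orbit_space \<Gamma>) g"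
  shows False
proof -
  obtain b z where b: "continuous_on UNIV b" "\<And>v. g (orbit \<Gamma> v) = orbit \<Gamma> (b v)"
    and z: "(z, mat 1) \<in> \<Gamma>" "z $ 1 = 0" "z $ 2 = 0"
    and bf: "\<And>v. b (act (shift, L) v) = act (z, mat 1) (act (shift, L) (b v))"
    using infranil_automorphism_lift[OF assms(1)] by blast
  obtain k c where k: "bij k" and c: "c \<in> \<Gamma>" "\<And>x. k (act \<alpha> x) = act c (b (k x))"
    and fwd: "\<And>g. g \<in> \<Gamma> \<Longrightarrow> \<exists>g'\<in>\<Gamma>. \<forall>x. k (act g x) = act g' (k x)"
    and bwd: "\<And>g'. g' \<in> \<Gamma> \<Longrightarrow> \<exists>g\<in>\<Gamma>. \<forall>x. k (act g x) = act g' (k x)"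
    by (rule \<Gamma>.lift_conjugacy[OF induced_alpha b(2) b(1) assms(2)]) (rule that; assumption)
  have inj: "k x = k y \<Longrightarrow> x = y" for x y using k by (simp add: bij_def inj_eq)
  let ?f = "(shift, L) :: 4 aff" and ?z = "(z, mat 1) :: 4 aff" and ?e = "(axis 1 1, mat 1) :: 4 aff"
  have gens: "?f \<in> \<Gamma>" "?e \<in> \<Gamma>" by (simp_all add: mem_\<Gamma> integer_lattice_iff axis_def)
  obtain f' where f': "f' \<in> \<Gamma>" "\<And>x. k (act f' x) = act ?f (k x)" using bwd[OF gens(1)] by blast
  obtain z' where z': "z' \<in> \<Gamma>" "\<And>x. k (act z' x) = act ?z (k x)" using bwd[OF z(1)] by blast
  obtain e' where e': "e' \<in> \<Gamma>" "\<And>x. k (act e' x) = act ?e (k x)" using bwd[OF gens(2)] by blast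
  obtain t where t: "t \<in> \<Gamma>" "\<And>x. k (act t x) = act c (k x)" using bwd[OF c(1)] by blast
  \<comment> \<open>Everything is pulled back along the lifted conjugacy to an identity between affine maps.\<close>
  have rel: "act \<alpha> (act f' x) = act z' (act t (act f' (act (ainv t) (act \<alpha> x))))" for x
  proof (rule inj)
    have "act c (k (act (ainv t) (act \<alpha> x))) = act c (b (k x))"
      using t c(2)[of x] by (metis \<Gamma>.act_inv(2))
    then have "k (act (ainv t) (act \<alpha> x)) = b (k x)"
      using c(1) by (metis \<Gamma>.act_inv(1))
    then show "k (act \<alpha> (act f' x)) = k (act z' (act t (act f' (act (ainv t) (act \<alpha> x)))))"
      by (simp add: c(2) f'(2) bf z'(2) t(2) central_translation[OF z(2,3) c(1)])
  qed
  have central: "act z' (act h x) = act h (act z' x)" if h: "h \<in> \<Gamma>" for h x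
  proof (rule inj)
    obtain h' where h': "h' \<in> \<Gamma>" "\<And>x. k (act h x) = act h' (k x)" using fwd[OF h] by blast
    then show "k (act z' (act h x)) = k (act h (act z' x))"
      by (simp add: z'(2) central_translation[OF z(2,3) h'(1)])
  qed
  obtain m where m: "z' = (m, mat 1)" "m $ 1 = 0" "m $ 2 = 0"
  proof -
    obtain m B where mB: "z' = (m, B)" by (cases z')
    have "B \<noteq> L"
    proof
      assume "B = L"
      then show False
        using arg_cong[OF central[OF gens(2), of 0], of "\<lambda>v. v $ 1"] mB by (simp add: act_def axis_def)
    qed
    then have "B = mat 1" using z'(1) mB by (auto simp: mem_\<Gamma>)
    moreover have "m $ 1 = 0" "m $ 2 = 0"
      using arg_cong[OF central[OF gens(1), of 0], of "\<lambda>v. v $ 1"]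
        arg_cong[OF central[OF gens(1), of 0], of "\<lambda>v. v $ 2"] mB \<open>B = mat 1\<close> by (simp_all add: act_def)
    ultimately show thesis using that mB by blast
  qed
  obtain v B where vB: "f' = (v, B)" by (cases f')
  have "B \<noteq> mat 1"
  proof
    assume B: "B = mat 1"
    \<comment> \<open>Squares in the group are translations, so a translation commutes with the square of the element
      corresponding to the first basis translation; but the screw motion does not commute with that.\<close>
    have "act f' (act e' (act e' x)) = act e' (act e' (act f' x))" for x
      using e'(1) by (cases e') (auto simp: mem_\<Gamma> vB B act_def matrix_vector_right_distrib matrix_vector_mul_assoc algebra_simps)
    then have "k (act f' (act e' (act e' x))) = k (act e' (act e' (act f' x)))" for x by simp
    then have "act ?f (act ?e (act ?e (k x))) = act ?e (act ?e (act ?f (k x)))" for x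
      by (simp add: e'(2) f'(2))
    then have "act ?f (act ?e (act ?e (k 0))) $ 1 = act ?e (act ?e (act ?f (k 0))) $ 1" by simp
    then show False by (simp add: act_def axis_def)
  qed
  then have f'L: "B = L" "v - shift \<in> integer_lattice" using f'(1) vB by (auto simp: mem_\<Gamma>)
  then obtain p q :: int where pq: "v $ 1 = of_int p" "v $ 2 = of_int q"
    by (auto simp: integer_lattice_iff elim!: Ints_cases)
  obtain w D where wD: "t = (w, D)" by (cases t)
  have "w $ 1 \<in> \<int>" using t(1) wD by (auto simp: mem_\<Gamma> integer_lattice_iff)
  then obtain r :: int where r: "w $ 1 = of_int r" by (auto elim: Ints_cases)
  consider "D = mat 1" | "D = L" using t(1) wD by (auto simp: mem_\<Gamma>)
  then show False
  proof cases
    case 1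
    have "13 * real_of_int p + 8 * of_int q + 1 = of_int p + 2 * of_int r"
      using arg_cong[OF rel[of 0], of "\<lambda>v. v $ 1"] m vB f'L wD 1 pq r
      by (simp add: act_def inv_1)
    then have "13 * p + 8 * q + 1 = p + 2 * r" by linarith
    then show False by presburger
  next
    case 2
    have "13 * real_of_int p + 8 * of_int q + 1 = 2 * of_int r - of_int p"
      using arg_cong[OF rel[of 0], of "\<lambda>v. v $ 1"] m vB f'L wD 2 pq r
      by (simp add: act_def inv_L)
    then have "13 * p + 8 * q + 1 = 2 * r - p" by linarith
    then show False by presburger
  qed
qed

theorem mainTheorem4:
  shows "subgroup \<Gamma> (semidirect F) \<and> torsion_free (semidirect F) \<Gamma> \<and> discrete \<Gamma> \<and>
      uniform_subgroup (semidirect F) \<Gamma> \<and>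
    (\<lambda>g. \<alpha> \<otimes>\<^bsub>affine_group\<^esub> g \<otimes>\<^bsub>affine_group\<^esub> inv\<^bsub>affine_group\<^esub> \<alpha>) ` \<Gamma> = \<Gamma> \<and>
    (\<forall>v. induced_map \<Gamma> (act \<alpha>) (orbit \<Gamma> v) = orbit \<Gamma> (act \<alpha> v)) \<and>
    anosov_diffeomorphism (orbit_space \<Gamma>) (orbit_atlas \<Gamma>) (induced_map \<Gamma> (act \<alpha>)) \<and>
    \<not> (\<exists>g. infranil_automorphism \<Gamma> F g \<and>
         topologically_conjugate (orbit_space \<Gamma>) (induced_map \<Gamma> (act \<alpha>)) (orbit_space \<Gamma>) g)"
proof -
  have "uniform_subgroup (semidirect F) \<Gamma>"
    by (rule \<Gamma>.uniform_semidirect[OF _ \<Gamma>_F]) (auto simp: F_def)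
  then show ?thesis
    using subgroup_semidirect[OF subgroup_UNIV_F subgroup_\<Gamma> \<Gamma>_F] \<Gamma>.torsion_free_semidirect \<Gamma>.discrete
      alpha_normalizes induced_alpha anosov_alpha not_conjugate by blast
qed

end
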